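(* Let $\theta\in\mathbb R\setminus\mathbb Q$. The periodic cyclic cohomology of $\mathcal A_\theta^{alg}\rtimes\mathbb Z_2$ satisfies $HC^{even}(\mathcal A_\theta^{alg}\rtimes\mathbb Z_2)\cong\mathbb C^6$ and $HC^{odd}(\mathcal A_\theta^{alg}\rtimes\mathbb Z_2)=0$.
   Context: Let $\lambda=e^{2\pi i\theta}$. The algebraic noncommutative torus $\mathcal A_\theta^{alg}$ is the complex algebra of finite linear combinations $\sum a_{n,m}U_1^nU_2^m$ generated by invertible $U_1,U_2$ with $U_2U_1=\lambda U_1U_2$. $\mathbb Z_2$ acts by the automorphism $\sigma(U_j)=U_j^{-1}$, and $\mathcal A_\theta^{alg}\rtimes\mathbb Z_2$ is generated by $\mathcal A_\theta^{alg}$ and $t$ with $t^2=1$, $tat=\sigma(a)$. $HC^{even}$, $HC^{odd}$ denote the even and odd periodic cyclic cohomology. *)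

theory Defs
  imports Complex_Main
begin

text \<open>Monomial basis of the crossed product A_theta^alg x| Z_2:
  (n, m, e) stands for U1^n U2^m t^e (e = True meaning one factor t).\<close>
type_synonym mon = "int \<times> int \<times> bool"

definition lam :: "real \<Rightarrow> int \<Rightarrow> complex" where
  "lam \<theta> k = exp (2 * complex_of_real pi * \<i> * complex_of_real (\<theta> * real_of_int k))"

text \<open>Product of two basis monomials: a scalar times a basis monomial.
  Uses U2 U1 = lambda U1 U2, t^2 = 1, t a = sigma(a) t with sigma(U_j) = U_j^-1.\<close>
definition mmul :: "real \<Rightarrow> mon \<Rightarrow> mon \<Rightarrow> complex \<times> mon" where
  "mmul \<theta> x y = (case x of (n, m, e) \<Rightarrow> case y of (p, q, f) \<Rightarrow>
     (let s = (if e then -1 else 1 :: int)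
      in (lam \<theta> (s * m * p), (n + s * p, m + s * q, e \<noteq> f))))"

definition one_mon :: mon where "one_mon = (0, 0, False)"

text \<open>An n-cochain (multilinear functional on A^(n+1)) is determined by its values
  on (n+1)-tuples of basis monomials; a family of cochains of all degrees is a
  function on lists of basis monomials (lists of length n+1 carry degree n).\<close>
type_synonym cochain = "mon list \<Rightarrow> complex"

definition hoch_b :: "real \<Rightarrow> cochain \<Rightarrow> cochain" where
  "hoch_b \<theta> \<phi> xs = (let k = length xs in
     if k < 2 then 0 else
       (\<Sum>i<k - 1. (-1) ^ i *
          (let (c, z) = mmul \<theta> (xs ! i) (xs ! (i + 1))
           in c * \<phi> (take i xs @ z # drop (i + 2) xs)))
       + (-1) ^ (k - 1) *
          (let (c, z) = mmul \<theta> (xs ! (k - 1)) (xs ! 0)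
           in c * \<phi> (z # take (k - 2) (drop 1 xs))))"

definition connes_B :: "cochain \<Rightarrow> cochain" where
  "connes_B \<phi> xs = (let k = length xs in
     if k = 0 then 0 else
       (\<Sum>j<k. (-1) ^ ((k - 1) * j) *
          (\<phi> (one_mon # rotate j xs) - (-1) ^ k * \<phi> (rotate j xs @ [one_mon]))))"

definition bB :: "real \<Rightarrow> cochain \<Rightarrow> cochain" where
  "bB \<theta> \<phi> = (\<lambda>xs. hoch_b \<theta> \<phi> xs + connes_B \<phi> xs)"

text \<open>Periodic complex: finitely many nonzero components (direct sum).\<close>
definition finitary :: "cochain \<Rightarrow> bool" where
  "finitary \<phi> \<longleftrightarrow> (\<exists>N. \<forall>xs. N < length xs \<longrightarrow> \<phi> xs = 0)"

definition even_cochain :: "cochain \<Rightarrow> bool" where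
  "even_cochain \<phi> \<longleftrightarrow> finitary \<phi> \<and> (\<forall>xs. even (length xs) \<longrightarrow> \<phi> xs = 0)"

definition odd_cochain :: "cochain \<Rightarrow> bool" where
  "odd_cochain \<phi> \<longleftrightarrow> finitary \<phi> \<and> \<phi> [] = 0 \<and> (\<forall>xs. odd (length xs) \<longrightarrow> \<phi> xs = 0)"

definition HP_even_cocycles :: "real \<Rightarrow> cochain set" where
  "HP_even_cocycles \<theta> = {\<phi>. even_cochain \<phi> \<and> bB \<theta> \<phi> = (\<lambda>_. 0)}"
definition HP_even_coboundaries :: "real \<Rightarrow> cochain set" where
  "HP_even_coboundaries \<theta> = {bB \<theta> \<psi> | \<psi>. odd_cochain \<psi>}"
definition HP_odd_cocycles :: "real \<Rightarrow> cochain set" where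
  "HP_odd_cocycles \<theta> = {\<phi>. odd_cochain \<phi> \<and> bB \<theta> \<phi> = (\<lambda>_. 0)}"
definition HP_odd_coboundaries :: "real \<Rightarrow> cochain set" where
  "HP_odd_coboundaries \<theta> = {bB \<theta> \<psi> | \<psi>. even_cochain \<psi>}"

definition quotient_dim :: "cochain set \<Rightarrow> cochain set \<Rightarrow> nat \<Rightarrow> bool" where
  "quotient_dim Z B d \<longleftrightarrow> (\<exists>f :: nat \<Rightarrow> cochain.
     (\<forall>i<d. f i \<in> Z) \<and>
     (\<forall>\<phi>\<in>Z. \<exists>c :: nat \<Rightarrow> complex. (\<lambda>xs. \<phi> xs - (\<Sum>i<d. c i * f i xs)) \<in> B) \<and>
     (\<forall>c :: nat \<Rightarrow> complex. (\<lambda>xs. \<Sum>i<d. c i * f i xs) \<in> B \<longrightarrow> (\<forall>i<d. c i = 0)))"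

end

theory Submission
  imports Defs
begin

text \<open>
  The crossed product is the twisted group algebra of \<open>G = Z\<^sup>2 \<rtimes> Z\<^sub>2\<close>, so a Hochschild cochain is the
  same as a function of \<open>g\<^sub>0, \<dots>, g\<^sub>n, x \<in> G\<close> that is equivariant, up to a phase, under left
  multiplication of the \<open>g\<^sub>i\<close> and conjugation of \<open>x\<close>; the Hochschild coboundary becomes the simplicial
  one. The complex splits according to \<open>x\<close>. For a nonzero translation \<open>x\<close>, the translation
  orthogonal to \<open>x\<close> fixes \<open>x\<close> but acts on it by a power of \<open>\<lambda>\<close> other than 1, and a prism homotopy shows
  that nothing survives. For a reflection the stabiliser is finite and averaging leaves only degree 0,
  one trace for each of the four conjugacy classes. For \<open>x = 1\<close> one is left with the group cohomology
  of \<open>G\<close>, which the square tiling of the plane computes: the canonical trace in degree 0 and the area cocycle in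
  degree 2. So the Hochschild cohomology has dimensions 5, 0, 1, 0, 0, \<open>\<dots>\<close>; being concentrated in
  even degrees, it determines the periodic cyclic cohomology by peeling off top components.
\<close>

text \<open>Cochains are arbitrary functions on tuples of monomials, without continuity or growth
  conditions, so dividing by \<open>\<lambda>^k - 1\<close> only requires it to be nonzero:
  irrationality of \<open>\<theta>\<close> suffices and small denominators do no harm. The unit
  class resists averaging because its stabiliser is all of the infinite group. Cells of the plane
  have stabilisers of order 2, so a cocycle is pushed by averaging from the group to vertices, edges
  and squares, and brought back by summation over the grid, the plane having no cohomology of its
  own. Degree is list length minus one: Hochschild degrees 0 and 2 appear as lengths 1 and 3. The
  Hochschild cocycle of length 3 becomes a \<open>b + B\<close> cocycle after a correction in length
  1, which exists because Hochschild cohomology vanishes in degree 1. With the five traces this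
  gives six classes. Cochains have finite support, so peeling off top components ends.\<close>

definition sg :: "bool \<Rightarrow> int" where "sg e = (if e then -1 else 1)"

fun gmul :: "mon \<Rightarrow> mon \<Rightarrow> mon" where
  "gmul (n, m, e) (p, q, f) = (n + sg e * p, m + sg e * q, e \<noteq> f)"

fun ginv :: "mon \<Rightarrow> mon" where
  "ginv (n, m, e) = (- sg e * n, - sg e * m, e)"

text \<open>The 2-cocycle of the twisted group algebra: the power of \<open>\<lambda>\<close> that
  appears when \<open>U2^m\<close> moves past \<open>U1^(sg e * p)\<close>.\<close>

fun mexp :: "mon \<Rightarrow> mon \<Rightarrow> int" where
  "mexp (n, m, e) (p, q, f) = sg e * m * p"

lemma mmul_eq: "mmul \<theta> x y = (lam \<theta> (mexp x y), gmul x y)"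
  by (cases x; cases y) (simp add: mmul_def sg_def Let_def)

lemma lam_0 [simp]: "lam \<theta> 0 = 1"
  by (simp add: lam_def)

lemma lam_add: "lam \<theta> (k + l) = lam \<theta> k * lam \<theta> l"
  by (simp add: lam_def exp_add [symmetric] algebra_simps)

lemma lam_nonzero [simp]: "lam \<theta> k \<noteq> 0"
  by (simp add: lam_def)

lemma gmul_one [simp]: "gmul one_mon x = x" "gmul x one_mon = x"
  by (cases x; simp add: one_mon_def sg_def)+

lemma mexp_one [simp]: "mexp one_mon x = 0" "mexp x one_mon = 0"
  by (cases x; simp add: one_mon_def)+

section \<open>Cyclic operators\<close>

definition cyc :: "cochain \<Rightarrow> cochain" where
  "cyc \<phi> xs = (-1) ^ (length xs - 1) * \<phi> (rotate1 xs)"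

definition cnorm :: "cochain \<Rightarrow> cochain" where
  "cnorm \<phi> xs = (\<Sum>j<length xs. (cyc ^^ j) \<phi> xs)"

definition mulfst :: "real \<Rightarrow> cochain \<Rightarrow> cochain" where
  "mulfst \<theta> \<phi> xs = (if length xs < 2 then 0 else
     lam \<theta> (mexp (xs ! 0) (xs ! 1)) * \<phi> (gmul (xs ! 0) (xs ! 1) # drop 2 xs))"

definition bprime :: "real \<Rightarrow> cochain \<Rightarrow> cochain" where
  "bprime \<theta> \<phi> xs = (\<Sum>i<length xs - 1. (-1) ^ i * (lam \<theta> (mexp (xs ! i) (xs ! (i + 1))) *
     \<phi> (take i xs @ gmul (xs ! i) (xs ! (i + 1)) # drop (i + 2) xs)))"

lemma hoch_b_short: "length xs < 2 \<Longrightarrow> hoch_b \<theta> \<phi> xs = 0"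
  by (simp add: hoch_b_def)

lemma hoch_b_bprime:
  assumes "2 \<le> length xs"
  shows "hoch_b \<theta> \<phi> xs = bprime \<theta> \<phi> xs + (-1) ^ (length xs - 1) *
     (lam \<theta> (mexp (last xs) (hd xs)) * \<phi> (gmul (last xs) (hd xs) # butlast (tl xs)))"
proof -
  have "xs \<noteq> []" using assms by auto
  then have "xs ! (length xs - Suc 0) = last xs" "xs ! 0 = hd xs"
    by (simp_all add: last_conv_nth hd_conv_nth)
  moreover have "take (length xs - 2) (drop (Suc 0) xs) = butlast (tl xs)"
    by (simp add: butlast_conv_take drop_Suc numeral_2_eq_2)
  ultimately show ?thesis
    using assms by (simp add: hoch_b_def bprime_def mmul_eq Let_def)
qed

lemma cyc_pow: "(cyc ^^ j) \<phi> xs = (-1) ^ ((length xs - 1) * j) * \<phi> (rotate j xs)"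
proof (induction j arbitrary: xs)
  case (Suc j)
  have "rotate j (rotate1 xs) = rotate (Suc j) xs"
    by (metis funpow_swap1 rotate_def funpow.simps(2) o_apply)
  moreover have "(cyc ^^ Suc j) \<phi> xs = (-1) ^ (length xs - 1) * (cyc ^^ j) \<phi> (rotate1 xs)"
    by (simp only: funpow.simps o_apply cyc_def [of "(cyc ^^ j) \<phi>"])
  ultimately show ?case by (simp add: Suc power_add)
qed simp

text \<open>On lists of length \<open>k\<close> the signs multiply to
  \<open>(-1)^((k-1) * k) = 1\<close>, so the signed rotation still has order dividing
  \<open>k\<close>.\<close>

lemma cyc_pow_length: "(cyc ^^ length xs) \<phi> xs = \<phi> xs"
proof -
  have "even ((length xs - 1) * length xs)" by (cases "length xs") auto
  then show ?thesis by (simp add: cyc_pow)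
qed

lemma cyc_pow_cong:
  assumes "\<And>ys. length ys = length xs \<Longrightarrow> \<phi> ys = \<psi> ys"
  shows "(cyc ^^ j) \<phi> xs = (cyc ^^ j) \<psi> xs"
  by (simp add: cyc_pow assms)

lemma cnorm_cong:
  assumes "\<And>ys. length ys = length xs \<Longrightarrow> \<phi> ys = \<psi> ys"
  shows "cnorm \<phi> xs = cnorm \<psi> xs"
  unfolding cnorm_def by (intro sum.cong refl cyc_pow_cong assms)

lemma cnorm_add: "cnorm (\<lambda>ys. \<phi> ys + \<psi> ys) xs = cnorm \<phi> xs + cnorm \<psi> xs"
  by (simp add: cnorm_def cyc_pow sum.distrib algebra_simps)

lemma cnorm_diff: "cnorm (\<lambda>ys. \<phi> ys - \<psi> ys) xs = cnorm \<phi> xs - cnorm \<psi> xs"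
  by (simp add: cnorm_def cyc_pow sum_subtractf algebra_simps)

lemma cnorm_sum: "cnorm (\<lambda>ys. \<Sum>i\<in>I. \<phi> i ys) xs = (\<Sum>i\<in>I. cnorm (\<phi> i) xs)"
  by (simp add: cnorm_def cyc_pow sum_distrib_left) (rule sum.swap)

lemma cyc_pow_cyc_pow: "(cyc ^^ i) ((cyc ^^ j) \<phi>) = (cyc ^^ (i + j)) \<phi>"
  by (simp add: funpow_add)

lemma sum_cyc_shift: "(\<Sum>j<length xs. (cyc ^^ (j + i)) \<phi> xs) = cnorm \<phi> xs"
proof (induction i)
  case 0
  then show ?case by (simp add: cnorm_def)
next
  case (Suc i)
  have "(\<Sum>j<length xs. (cyc ^^ (j + Suc i)) \<phi> xs)
      = (\<Sum>j<length xs. (cyc ^^ (j + i)) \<phi> xs) + (cyc ^^ (length xs + i)) \<phi> xs - (cyc ^^ i) \<phi> xs"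
    using sum.lessThan_Suc_shift [of "\<lambda>j. (cyc ^^ (j + i)) \<phi> xs" "length xs"]
    by (simp add: algebra_simps)
  also have "(cyc ^^ (length xs + i)) \<phi> xs = (cyc ^^ i) \<phi> xs"
    by (metis cyc_pow_cyc_pow cyc_pow_length)
  finally show ?case using Suc by simp
qed

lemma cnorm_cyc_pow: "cnorm ((cyc ^^ i) \<phi>) xs = cnorm \<phi> xs"
  using sum_cyc_shift [where i = i] by (simp add: cnorm_def cyc_pow_cyc_pow)

lemma cyc_pow_cnorm: "(cyc ^^ i) (cnorm \<phi>) xs = cnorm \<phi> xs"
proof -
  have "(cyc ^^ i) (cnorm \<phi>) xs = (\<Sum>j<length xs. (cyc ^^ (j + i)) \<phi> xs)"
    unfolding add.commute [of _ i] cyc_pow_cyc_pow [symmetric]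
    by (simp add: cyc_pow [of i] cnorm_def sum_distrib_left)
  then show ?thesis by (simp add: sum_cyc_shift)
qed

lemma mulfst_cong:
  assumes "\<And>ys. Suc (length ys) = length xs \<Longrightarrow> \<phi> ys = \<psi> ys"
  shows "mulfst \<theta> \<phi> xs = mulfst \<theta> \<psi> xs"
  using assms by (simp add: mulfst_def)

lemma mulfst_sum: "mulfst \<theta> (\<lambda>ys. \<Sum>i\<in>I. \<phi> i ys) xs = (\<Sum>i\<in>I. mulfst \<theta> (\<phi> i) xs)"
  by (simp add: mulfst_def sum_distrib_left)

text \<open>Every face is conjugate to the first one, \<open>e = mulfst\<close>, by a cyclic permutation. Hence
  both \<open>N b'\<close> and \<open>b N\<close> equal \<open>N e N\<close>, where \<open>N = cnorm\<close>.\<close>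

lemma face_conjugate:
  assumes "i + 1 < length xs"
  shows "(cyc ^^ i) (mulfst \<theta> ((cyc ^^ (length xs - 1 - i)) \<phi>)) xs
    = (-1) ^ i * (lam \<theta> (mexp (xs ! i) (xs ! (i + 1))) *
        \<phi> (take i xs @ gmul (xs ! i) (xs ! (i + 1)) # drop (i + 2) xs))"
proof -
  define p a b s where "p = take i xs" and "a = xs ! i" and "b = xs ! (i + 1)" and "s = drop (i + 2) xs"
  have xs: "xs = p @ a # b # s" and i: "i = length p"
    using assms unfolding p_def a_def b_def s_def
    by (simp_all add: Cons_nth_drop_Suc)
  have r1: "rotate i xs = a # b # s @ p"
    unfolding xs i by (simp add: rotate_append)
  have l: "length xs - 1 - i = length (gmul a b # s)" using xs i by simp
  have r2: "rotate (length (gmul a b # s)) ((gmul a b # s) @ p) = p @ gmul a b # s"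
    by (rule rotate_append)
  have c: "(cyc ^^ length (gmul a b # s)) \<phi> (gmul a b # s @ p)
      = (-1) ^ ((length s + length p) * Suc (length s)) * \<phi> (p @ gmul a b # s)"
    using r2 by (simp only: cyc_pow append_Cons) simp
  \<comment> \<open>With \<open>p\<close>, \<open>s\<close> standing for the lengths, the exponents
    are \<open>(p+s+1) p\<close> and \<open>(p+s) (s+1)\<close>; they add up to
    \<open>(p+s) (p+s+1) + p\<close>, which has the parity of \<open>p\<close>.\<close>
  have ev: "even ((length xs - 1) * i + (length s + length p) * Suc (length s)) \<longleftrightarrow> even i"
    unfolding xs i by auto
  have sgn: "(-1::complex) ^ ((length xs - 1) * i) * (-1) ^ ((length s + length p) * Suc (length s)) = (-1) ^ i"
    by (metis ev minus_one_power_iff power_add)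
  have "(cyc ^^ i) (mulfst \<theta> ((cyc ^^ (length xs - 1 - i)) \<phi>)) xs
    = (-1) ^ ((length xs - 1) * i) * mulfst \<theta> ((cyc ^^ (length xs - 1 - i)) \<phi>) (a # b # s @ p)"
    by (simp only: cyc_pow r1)
  also have "\<dots> = (-1) ^ ((length xs - 1) * i) * (lam \<theta> (mexp a b) *
      ((-1) ^ ((length s + length p) * Suc (length s)) * \<phi> (p @ gmul a b # s)))"
    unfolding l mulfst_def using c by simp
  also have "\<dots> = (-1) ^ i * (lam \<theta> (mexp a b) * \<phi> (p @ gmul a b # s))"
    unfolding sgn [symmetric] by simp
  finally show ?thesis unfolding p_def a_def b_def s_def .
qed

lemma bprime_conjugates:
  "bprime \<theta> \<phi> xs = (\<Sum>i<length xs - 1. (cyc ^^ i) (mulfst \<theta> ((cyc ^^ (length xs - 1 - i)) \<phi>)) xs)"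
  unfolding bprime_def by (intro sum.cong refl, subst face_conjugate) auto

text \<open>The wrap-around face is the additional term \<open>i = length xs - 1\<close>, in which
  the inner power of \<open>cyc\<close> is trivial.\<close>

lemma hoch_b_conjugates:
  assumes "2 \<le> length xs"
  shows "hoch_b \<theta> \<phi> xs = (\<Sum>i<length xs. (cyc ^^ i) (mulfst \<theta> ((cyc ^^ (length xs - 1 - i)) \<phi>)) xs)"
proof -
  obtain a r b where xs: "xs = (a # r) @ [b]"
    using assms by (metis One_nat_def Suc_1 append_butlast_last_id butlast.simps(1) length_Cons list.exhaust list.size(3) not_less_eq_eq numeral_2_eq_2 append_Nil bot_nat_0.extremum)
  have r: "rotate (length xs - 1) xs = b # a # r"
    unfolding xs using rotate_append [of "a # r" "[b]"] by simp
  have "(cyc ^^ (length xs - 1)) (mulfst \<theta> ((cyc ^^ 0) \<phi>)) xs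
     = (-1) ^ (length xs - 1) * (lam \<theta> (mexp b a) * \<phi> (gmul b a # r))"
    unfolding cyc_pow r by (simp add: mulfst_def minus_one_power_iff)
  moreover have "length xs = Suc (length xs - 1)" using assms by simp
  ultimately have "(\<Sum>i<length xs. (cyc ^^ i) (mulfst \<theta> ((cyc ^^ (length xs - 1 - i)) \<phi>)) xs)
      = bprime \<theta> \<phi> xs + (-1) ^ (length xs - 1) * (lam \<theta> (mexp b a) * \<phi> (gmul b a # r))"
    unfolding bprime_conjugates by (metis (no_types, lifting) diff_self_eq_0 sum.lessThan_Suc)
  then show ?thesis
    unfolding hoch_b_bprime [OF assms] by (simp add: xs)
qed

lemma cnorm_bprime:
  assumes "2 \<le> length xs"
  shows "cnorm (bprime \<theta> \<phi>) xs = hoch_b \<theta> (cnorm \<phi>) xs"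
proof -
  have "cnorm (bprime \<theta> \<phi>) xs
      = cnorm (\<lambda>ys. \<Sum>i<length xs - 1. (cyc ^^ i) (mulfst \<theta> ((cyc ^^ (length xs - 1 - i)) \<phi>)) ys) xs"
    by (rule cnorm_cong) (simp add: bprime_conjugates)
  also have "\<dots> = (\<Sum>i<length xs - 1. cnorm (mulfst \<theta> ((cyc ^^ (length xs - 1 - i)) \<phi>)) xs)"
    by (simp only: cnorm_sum cnorm_cyc_pow)
  also have "\<dots> = cnorm (mulfst \<theta> (\<lambda>ys. \<Sum>i<length xs - 1. (cyc ^^ (length xs - 1 - i)) \<phi> ys)) xs"
    unfolding mulfst_sum cnorm_sum [symmetric] by simp
  also have "\<dots> = cnorm (mulfst \<theta> (cnorm \<phi>)) xs"
  proof (intro cnorm_cong mulfst_cong)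
    fix ys zs :: "mon list"
    assume "length ys = length xs" "Suc (length zs) = length ys"
    then have l: "length xs - 1 = length zs" by simp
    \<comment> \<open>The powers run through \<open>1, ..., length zs\<close>, a full period of
      \<open>cyc\<close>, so the sum is the norm.\<close>
    have "(\<Sum>i<length zs. (cyc ^^ (length zs - i)) \<phi> zs) = (\<Sum>i<length zs. (cyc ^^ (i + 1)) \<phi> zs)"
      unfolding sum.nat_diff_reindex [of "\<lambda>i. (cyc ^^ (i + 1)) \<phi> zs", symmetric]
      by (intro sum.cong refl) (metis Suc_diff_Suc Suc_eq_plus1 lessThan_iff)
    then show "(\<Sum>i<length xs - 1. (cyc ^^ (length xs - 1 - i)) \<phi> zs) = cnorm \<phi> zs"
      unfolding l sum_cyc_shift .
  qed
  also have "\<dots> = hoch_b \<theta> (cnorm \<phi>) xs"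
    unfolding hoch_b_conjugates [OF assms] cnorm_def [of "mulfst _ _"]
    by (simp add: cyc_pow_cnorm cong: cyc_pow_cong mulfst_cong)
  finally show ?thesis .
qed

definition unit_ins :: "cochain \<Rightarrow> cochain" where
  "unit_ins \<phi> ys = \<phi> (one_mon # ys) - (-1) ^ length ys * \<phi> (ys @ [one_mon])"

lemma unit_ins_cyc: "unit_ins \<phi> ys = \<phi> (one_mon # ys) - cyc \<phi> (one_mon # ys)"
  by (simp add: unit_ins_def cyc_def)

lemma connes_B_cnorm: "connes_B \<phi> xs = cnorm (unit_ins \<phi>) xs"
  by (simp add: connes_B_def cnorm_def unit_ins_def cyc_pow Let_def)

text \<open>\<open>B = N s (1 - cyc)\<close>, where \<open>s\<close> puts the unit in front, and
  \<open>(1 - cyc) N = 0\<close> stands in the middle of \<open>B B\<close>.\<close>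

lemma connes_B_connes_B: "connes_B (connes_B \<phi>) xs = 0"
proof -
  have "unit_ins (connes_B \<phi>) ys = 0" for ys
    using cyc_pow_cnorm [of 1 "unit_ins \<phi>" "one_mon # ys"]
    by (simp add: unit_ins_cyc connes_B_cnorm [abs_def])
  then have "unit_ins (connes_B \<phi>) = (\<lambda>_. 0)" by auto
  then show ?thesis by (simp add: connes_B_cnorm [of "connes_B \<phi>"]) (simp add: cnorm_def cyc_pow)
qed

text \<open>The extra degeneracy of the bar complex: putting the unit in front is a contracting
  homotopy for \<open>bprime\<close>.\<close>

lemma bprime_one_Cons:
  assumes "ys \<noteq> []"
  shows "bprime \<theta> \<phi> (one_mon # ys) = \<phi> ys - bprime \<theta> (\<lambda>zs. \<phi> (one_mon # zs)) ys"
proof -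
  obtain y zs where ys: "ys = y # zs" using assms by (cases ys) auto
  show ?thesis
    unfolding bprime_def ys
    by (simp del: sum.lessThan_Suc add: sum.lessThan_Suc_shift sum_negf)
qed

lemma bprime_append_one:
  assumes "ys \<noteq> []"
  shows "bprime \<theta> \<phi> (ys @ [one_mon]) = bprime \<theta> (\<lambda>zs. \<phi> (zs @ [one_mon])) ys + (-1) ^ (length ys - 1) * \<phi> ys"
proof -
  obtain n where n: "length ys = Suc n" using assms by (cases ys) auto
  have "take n ys @ [ys ! n] = ys" using n by (metis lessI take_Suc_conv_app_nth take_all order_refl)
  then show ?thesis
    unfolding bprime_def using n by (simp add: nth_append)
qed

lemma unit_ins_hoch_b:
  assumes "ys \<noteq> []"
  shows "unit_ins (hoch_b \<theta> \<phi>) ys = \<phi> ys - (cyc ^^ (length ys - 1)) \<phi> ys - bprime \<theta> (unit_ins \<phi>) ys"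
proof -
  obtain n where n: "length ys = Suc n" using assms by (cases ys) auto
  have ys: "ys = butlast ys @ [last ys]" and l: "length (butlast ys) = n" using assms n by auto
  have "rotate n ys = last ys # butlast ys"
    using rotate_append [of "butlast ys" "[last ys]"] ys l by simp
  then have c: "(cyc ^^ (length ys - 1)) \<phi> ys = (-1) ^ n * \<phi> (last ys # butlast ys)"
    by (simp add: cyc_pow n minus_one_power_iff)
  have h1: "hoch_b \<theta> \<phi> (one_mon # ys) = \<phi> ys - bprime \<theta> (\<lambda>zs. \<phi> (one_mon # zs)) ys
      - (-1) ^ n * \<phi> (last ys # butlast ys)"
    using assms n by (subst hoch_b_bprime) (auto simp: bprime_one_Cons)
  have h2: "hoch_b \<theta> \<phi> (ys @ [one_mon]) = bprime \<theta> (\<lambda>zs. \<phi> (zs @ [one_mon])) ys"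
    using assms n by (subst hoch_b_bprime) (auto simp: bprime_append_one)
  have "bprime \<theta> (unit_ins \<phi>) ys = bprime \<theta> (\<lambda>zs. \<phi> (one_mon # zs)) ys
      - (-1) ^ n * bprime \<theta> (\<lambda>zs. \<phi> (zs @ [one_mon])) ys"
    unfolding bprime_def unit_ins_def
    by (simp add: n sum_distrib_left sum_subtractf [symmetric] algebra_simps cong: sum.cong_simp)
  then show ?thesis
    unfolding unit_ins_def [of "hoch_b _ _"] h1 h2 c using n by (simp add: algebra_simps)
qed

text \<open>Under \<open>cnorm\<close> the first two terms of \<open>unit_ins_hoch_b\<close> cancel,
  being cyclic translates of each other, and \<open>cnorm_bprime\<close> turns the third into
  \<open>- b B\<close>.\<close>

lemma hoch_b_connes_B: "hoch_b \<theta> (connes_B \<phi>) xs + connes_B (hoch_b \<theta> \<phi>) xs = 0"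
proof (cases "xs = []")
  case True
  then show ?thesis by (simp add: hoch_b_def connes_B_def)
next
  case False
  have "connes_B (hoch_b \<theta> \<phi>) xs
      = cnorm (\<lambda>ys. \<phi> ys - (cyc ^^ (length xs - 1)) \<phi> ys - bprime \<theta> (unit_ins \<phi>) ys) xs"
    unfolding connes_B_cnorm using False by (intro cnorm_cong) (metis unit_ins_hoch_b length_0_conv)
  also have "\<dots> = - cnorm (bprime \<theta> (unit_ins \<phi>)) xs"
    by (simp add: cnorm_diff cnorm_cyc_pow)
  also have "\<dots> = - hoch_b \<theta> (connes_B \<phi>) xs"
  proof (cases "2 \<le> length xs")
    case True
    then show ?thesis by (simp add: cnorm_bprime connes_B_cnorm [abs_def])
  next
    case False
    then have "cnorm (bprime \<theta> (unit_ins \<phi>)) xs = cnorm (\<lambda>_. 0) xs"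
      by (intro cnorm_cong) (simp add: bprime_def)
    then show ?thesis using False by (simp add: hoch_b_short) (simp add: cnorm_def cyc_pow)
  qed
  finally show ?thesis by simp
qed

section \<open>Simplicial cochains\<close>

text \<open>The simplicial coboundary, an alternating sum of omissions (\<open>dlt_eq_sum\<close>).
  The recursive form lets identities be proved by induction on the list, with \<open>f\<close>
  replaced by \<open>f\<close> after a fixed first vertex.\<close>

fun dlt :: "(mon list \<Rightarrow> complex) \<Rightarrow> mon list \<Rightarrow> complex" where
  "dlt f [] = 0"
| "dlt f (g # gs) = f gs - dlt (\<lambda>l. f (g # l)) gs"

lemma dlt_cong:
  assumes "\<And>l. Suc (length l) = length gs \<Longrightarrow> f l = h l"
  shows "dlt f gs = dlt h gs"
  using assms
proof (induction gs arbitrary: f h)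
  case (Cons g gs)
  have "dlt (\<lambda>l. f (g # l)) gs = dlt (\<lambda>l. h (g # l)) gs" by (rule Cons.IH) (simp add: Cons.prems)
  then show ?case by (simp add: Cons.prems)
qed simp

lemma dlt_zero [simp]: "dlt (\<lambda>_. 0) gs = 0"
  by (induction gs) auto

lemma dlt_add: "dlt (\<lambda>l. f l + h l) gs = dlt f gs + dlt h gs"
  by (induction gs arbitrary: f h) (auto simp: algebra_simps)

lemma dlt_diff: "dlt (\<lambda>l. f l - h l) gs = dlt f gs - dlt h gs"
  by (induction gs arbitrary: f h) (auto simp: algebra_simps)

lemma dlt_cmult: "dlt (\<lambda>l. c * f l) gs = c * dlt f gs"
  by (induction gs arbitrary: f) (auto simp: algebra_simps)

lemma dlt_dlt [simp]: "dlt (dlt f) gs = 0"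
proof (induction gs arbitrary: f)
  case (Cons g gs)
  have "dlt (\<lambda>l. dlt f (g # l)) gs = dlt f gs - dlt (dlt (\<lambda>l. f (g # l))) gs"
    by (simp add: dlt_diff)
  then show ?case by (simp add: Cons)
qed simp

lemma dlt_map: "dlt f (map u gs) = dlt (\<lambda>l. f (map u l)) gs"
  by (induction gs arbitrary: f) auto

lemma dlt_eq_sum: "dlt f gs = (\<Sum>i<length gs. (-1) ^ i * f (take i gs @ drop (Suc i) gs))"
proof (induction gs arbitrary: f)
  case (Cons g gs)
  show ?case
    by (simp del: sum.lessThan_Suc add: sum.lessThan_Suc_shift Cons sum_negf)
qed simp

text \<open>The alternating sum of \<open>f (g0, ..., gi, w gi, ..., w gn)\<close>, the triangulated
  prism between a simplex and its translate by \<open>w\<close>.\<close>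

fun prism :: "mon \<Rightarrow> (mon list \<Rightarrow> complex) \<Rightarrow> mon list \<Rightarrow> complex" where
  "prism w f [] = 0"
| "prism w f (g # gs) = f (g # map (gmul w) (g # gs)) - prism w (\<lambda>l. f (g # l)) gs"

lemma prism_diff: "prism w (\<lambda>l. f l - h l) gs = prism w f gs - prism w h gs"
  by (induction gs arbitrary: f h) (auto simp: algebra_simps)

lemma prism_zero: "prism w (\<lambda>_. 0) gs = 0"
  by (induction gs) auto

lemma prism_cong:
  assumes "\<And>l. length l = Suc (length gs) \<Longrightarrow> f l = h l"
  shows "prism w f gs = prism w h gs"
  using assms
proof (induction gs arbitrary: f h)
  case (Cons g gs)
  have "prism w (\<lambda>l. f (g # l)) gs = prism w (\<lambda>l. h (g # l)) gs" by (rule Cons.IH) (simp add: Cons.prems)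
  then show ?case by (simp add: Cons.prems)
qed simp

lemma prism_homotopy: "dlt (prism w f) gs + prism w (dlt f) gs = f (map (gmul w) gs) - f gs"
proof (induction gs arbitrary: f)
  case (Cons g gs)
  show ?case
    using Cons.IH [of "\<lambda>l. f (g # l)"]
    by (simp add: dlt_diff prism_diff dlt_map) algebra
qed simp

lemma prism_map:
  assumes "\<And>l. f' (map (gmul h) l) = c * f l" and "\<And>g. gmul w' (gmul h g) = gmul h (gmul w g)"
  shows "prism w' f' (map (gmul h) gs) = c * prism w f gs"
  using assms(1)
proof (induction gs arbitrary: f f')
  case (Cons g gs)
  have "prism w' (\<lambda>l. f' (gmul h g # l)) (map (gmul h) gs) = c * prism w (\<lambda>l. f (g # l)) gs"
    by (rule Cons.IH) (use Cons.prems in \<open>metis list.simps(9)\<close>)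
  moreover have "f' (gmul h g # map (gmul w') (gmul h g # map (gmul h) gs)) = c * f (g # map (gmul w) (g # gs))"
    using Cons.prems [of "g # map (gmul w) (g # gs)"] by (simp add: assms(2) o_def)
  ultimately show ?case by (simp add: algebra_simps)
qed simp

section \<open>Equivariant cochains\<close>

text \<open>The base set, the action and the phase are parameters so that the same contraction
  arguments serve both group elements under conjugation and cells of the plane. \<open>N\<close>
  counts vertices, one more than the degree.\<close>

definition ecoch :: "(mon \<Rightarrow> 'y \<Rightarrow> 'y) \<Rightarrow> (mon \<Rightarrow> 'y \<Rightarrow> complex) \<Rightarrow> nat \<Rightarrow> ('y \<Rightarrow> mon list \<Rightarrow> complex) \<Rightarrow> bool" where
  "ecoch a \<chi> N f \<longleftrightarrow> (\<forall>y gs. length gs \<noteq> N \<longrightarrow> f y gs = 0) \<and>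
     (\<forall>h y gs. f (a h y) (map (gmul h) gs) = \<chi> h y * f y gs)"

lemma ecoch_length: "ecoch a \<chi> N f \<Longrightarrow> length gs \<noteq> N \<Longrightarrow> f y gs = 0"
  by (simp add: ecoch_def)

lemma ecoch_act: "ecoch a \<chi> N f \<Longrightarrow> f (a h y) (map (gmul h) gs) = \<chi> h y * f y gs"
  unfolding ecoch_def by blast

lemma ecoch_add:
  "ecoch a \<chi> N f \<Longrightarrow> ecoch a \<chi> N f' \<Longrightarrow> ecoch a \<chi> N (\<lambda>y gs. f y gs + f' y gs)"
  by (simp add: ecoch_def algebra_simps)

lemma ecoch_diff:
  "ecoch a \<chi> N f \<Longrightarrow> ecoch a \<chi> N f' \<Longrightarrow> ecoch a \<chi> N (\<lambda>y gs. f y gs - f' y gs)"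
  by (simp add: ecoch_def algebra_simps)

lemma ecoch_cmult: "ecoch a \<chi> N f \<Longrightarrow> ecoch a \<chi> N (\<lambda>y gs. c * f y gs)"
  by (simp add: ecoch_def algebra_simps)

lemma ecoch_dlt:
  assumes "ecoch a \<chi> N f"
  shows "ecoch a \<chi> (Suc N) (\<lambda>y. dlt (f y))"
  unfolding ecoch_def
proof (intro conjI allI impI)
  fix y gs assume "length (gs :: mon list) \<noteq> Suc N"
  then have "dlt (f y) gs = dlt (\<lambda>_. 0) gs"
    by (intro dlt_cong ecoch_length [OF assms]) auto
  then show "dlt (f y) gs = 0" by simp
next
  fix h y gs
  show "dlt (f (a h y)) (map (gmul h) gs) = \<chi> h y * dlt (f y) gs"
    by (simp add: dlt_map ecoch_act [OF assms] dlt_cmult)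
qed

text \<open>Averaging over the finitely many group elements lying over \<open>y\<close> (a torsor under the
  stabiliser) contracts the complex.\<close>

lemma finite_stabiliser_acyclic:
  assumes f: "ecoch a \<chi> N f" and "2 \<le> N"
    and S: "\<And>h y. a h y \<in> S \<longleftrightarrow> y \<in> S"
    and \<gamma>: "\<And>h y. y \<in> S \<Longrightarrow> (\<gamma> (a h y) = gmul h (\<gamma> y) \<and> \<gamma>' (a h y) = gmul h (\<gamma>' y)) \<or>
                    (\<gamma> (a h y) = gmul h (\<gamma>' y) \<and> \<gamma>' (a h y) = gmul h (\<gamma> y))"
    and cocycle: "\<And>y gs. y \<in> S \<Longrightarrow> dlt (f y) gs = 0"
  obtains \<psi> where "ecoch a \<chi> (N - 1) \<psi>" "\<And>y gs. y \<in> S \<Longrightarrow> dlt (\<psi> y) gs = f y gs"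
    "\<And>y gs. y \<notin> S \<Longrightarrow> \<psi> y gs = 0"
proof
  \<comment> \<open>Adding a first vertex is the usual cone homotopy. Since \<open>h\<close> may
    exchange the two candidates for the cone point, only the average over both is
    equivariant.\<close>
  define \<psi> where "\<psi> = (\<lambda>y gs. if y \<in> S then (f y (\<gamma> y # gs) + f y (\<gamma>' y # gs)) / 2 else 0)"
  show "ecoch a \<chi> (N - 1) \<psi>"
    unfolding ecoch_def
  proof (intro conjI allI impI)
    fix y gs assume "length (gs :: mon list) \<noteq> N - 1"
    then show "\<psi> y gs = 0" using \<open>2 \<le> N\<close> by (auto simp: \<psi>_def ecoch_length [OF f])
  next
    fix h y gs
    have *: "f (a h y) (gmul h g # map (gmul h) gs) = \<chi> h y * f y (g # gs)" for g
      using ecoch_act [OF f, of h y "g # gs"] by simp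
    show "\<psi> (a h y) (map (gmul h) gs) = \<chi> h y * \<psi> y gs"
      using \<gamma> [of y h] * [of "\<gamma> y"] * [of "\<gamma>' y"] by (auto simp: \<psi>_def S algebra_simps add_divide_distrib)
  qed
  show "dlt (\<psi> y) gs = f y gs" if y: "y \<in> S" for y gs
  proof -
    \<comment> \<open>For each fixed cone point \<open>g\<close> the cocycle condition on
      \<open>g # gs\<close> says that the cone is a primitive.\<close>
    have *: "dlt (\<lambda>l. f y (g # l)) gs = f y gs" for g
      using cocycle [OF y, of "g # gs"] by simp
    have "\<psi> y = (\<lambda>gs. (1/2) * (f y (\<gamma> y # gs) + f y (\<gamma>' y # gs)))"
      using y by (auto simp: \<psi>_def)
    then show ?thesis by (simp only: dlt_cmult dlt_add *) simp
  qed
qed (simp_all)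

text \<open>If \<open>w y\<close> fixes \<open>y\<close> but acts on it by a scalar other than 1, the prism operator
  contracts the complex.\<close>

lemma nontrivial_character_acyclic:
  assumes f: "ecoch a \<chi> N f" and "1 \<le> N"
    and S: "\<And>h y. a h y \<in> S \<longleftrightarrow> y \<in> S"
    and fixed: "\<And>y. y \<in> S \<Longrightarrow> a (w y) y = y"
    and w: "\<And>h y g. y \<in> S \<Longrightarrow> gmul (w (a h y)) (gmul h g) = gmul h (gmul (w y) g)"
    and \<chi>: "\<And>y. y \<in> S \<Longrightarrow> \<chi> (w y) y \<noteq> 1"
    and \<chi>_act: "\<And>h y. y \<in> S \<Longrightarrow> \<chi> (w (a h y)) (a h y) = \<chi> (w y) y"
    and cocycle: "\<And>y gs. y \<in> S \<Longrightarrow> dlt (f y) gs = 0"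
  obtains \<psi> where "ecoch a \<chi> (N - 1) \<psi>" "\<And>y gs. y \<in> S \<Longrightarrow> dlt (\<psi> y) gs = f y gs"
    "\<And>y gs. y \<notin> S \<Longrightarrow> \<psi> y gs = 0"
proof
  \<comment> \<open>For a cocycle the prism is a primitive of the translate by \<open>w y\<close>
    minus \<open>f\<close>, that is of \<open>(\<chi> (w y) y - 1) * f\<close>, whence the
    normalising factor.\<close>
  define \<psi> where "\<psi> = (\<lambda>y gs. if y \<in> S then inverse (\<chi> (w y) y - 1) * prism (w y) (f y) gs else 0)"
  show "ecoch a \<chi> (N - 1) \<psi>"
    unfolding ecoch_def
  proof (intro conjI allI impI)
    fix y gs assume "length (gs :: mon list) \<noteq> N - 1"
    then have "prism (w y) (f y) gs = prism (w y) (\<lambda>_. 0) gs"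
      using \<open>1 \<le> N\<close> by (intro prism_cong ecoch_length [OF f]) auto
    then show "\<psi> y gs = 0" by (simp add: \<psi>_def prism_zero)
  next
    fix h y gs
    show "\<psi> (a h y) (map (gmul h) gs) = \<chi> h y * \<psi> y gs"
    proof (cases "y \<in> S")
      case True
      then have "prism (w (a h y)) (f (a h y)) (map (gmul h) gs) = \<chi> h y * prism (w y) (f y) gs"
        by (intro prism_map ecoch_act [OF f] w)
      then show ?thesis using True by (simp add: \<psi>_def S \<chi>_act)
    qed (simp add: \<psi>_def S)
  qed
  show "dlt (\<psi> y) gs = f y gs" if y: "y \<in> S" for y gs
  proof -
    have "dlt (f y) = (\<lambda>_. 0)" using cocycle [OF y] by auto
    then have "dlt (prism (w y) (f y)) gs = f y (map (gmul (w y)) gs) - f y gs"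
      using prism_homotopy [of "w y" "f y" gs] by (simp add: prism_zero)
    also have "\<dots> = (\<chi> (w y) y - 1) * f y gs"
      using ecoch_act [OF f, of "w y" y gs] by (simp add: fixed y algebra_simps)
    finally show ?thesis using y \<chi> [OF y] by (simp add: \<psi>_def dlt_cmult)
  qed
qed simp

section \<open>Cells of the plane\<close>

text \<open>\<open>Z\<^sup>2 \<rtimes> Z\<^sub>2\<close> acts on the square cell structure of the plane. A cell is named by its lower left
  corner; \<open>k1 k2 \<in> {0, 1}\<close> are its side lengths and \<open>s\<close> tells whether the point
  reflections preserve (1) or reverse (-1) its orientation.\<close>

fun cact :: "int \<Rightarrow> int \<Rightarrow> mon \<Rightarrow> int \<times> int \<Rightarrow> int \<times> int" where
  "cact k1 k2 (n, m, e) (z1, z2) = (if e then (n - z1 - k1, m - z2 - k2) else (n + z1, m + z2))"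

fun csgn :: "complex \<Rightarrow> mon \<Rightarrow> int \<times> int \<Rightarrow> complex" where
  "csgn s (n, m, e) z = (if e then s else 1)"

abbreviation cell :: "int \<Rightarrow> int \<Rightarrow> complex \<Rightarrow> nat \<Rightarrow> (int \<times> int \<Rightarrow> mon list \<Rightarrow> complex) \<Rightarrow> bool" where
  "cell k1 k2 s \<equiv> ecoch (cact k1 k2) (csgn s)"

text \<open>Homogeneous group cochains with trivial coefficients: the part of the Hochschild complex
  over the unit class.\<close>

definition pcoch :: "nat \<Rightarrow> (mon list \<Rightarrow> complex) \<Rightarrow> bool" where
  "pcoch N f \<longleftrightarrow> (\<forall>gs. length gs \<noteq> N \<longrightarrow> f gs = 0) \<and> (\<forall>h gs. f (map (gmul h) gs) = f gs)"

lemma cellI: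
  assumes "\<And>z gs. length gs \<noteq> N \<Longrightarrow> F z gs = 0"
    and "\<And>n m z1 z2 gs. length gs = N \<Longrightarrow> F (n + z1, m + z2) (map (gmul (n, m, False)) gs) = F (z1, z2) gs"
    and "\<And>n m z1 z2 gs. length gs = N \<Longrightarrow> F (n - z1 - k1, m - z2 - k2) (map (gmul (n, m, True)) gs) = s * F (z1, z2) gs"
  shows "cell k1 k2 s N F"
  unfolding ecoch_def
proof (intro conjI allI impI)
  fix h :: mon and z and gs :: "mon list"
  show "F (cact k1 k2 h z) (map (gmul h) gs) = csgn s h z * F z gs"
  proof (cases "length gs = N")
    case True
    obtain n m e z1 z2 where "h = (n, m, e)" "z = (z1, z2)" by (cases h; cases z)
    then show ?thesis using assms(2,3) [OF True, of n _ m] by auto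
  qed (simp add: assms(1))
qed (rule assms(1))

lemma cell_translate: "cell k1 k2 s N F \<Longrightarrow> F (n + z1, m + z2) (map (gmul (n, m, False)) gs) = F (z1, z2) gs"
  using ecoch_act [of "cact k1 k2" "csgn s" N F "(n, m, False)" "(z1, z2)" gs] by simp

lemma cell_reflect:
  "cell k1 k2 s N F \<Longrightarrow> F (n - z1 - k1, m - z2 - k2) (map (gmul (n, m, True)) gs) = s * F (z1, z2) gs"
  using ecoch_act [of "cact k1 k2" "csgn s" N F "(n, m, True)" "(z1, z2)" gs] by simp

lemma cell_acyclic:
  assumes "cell k1 k2 s N F" "2 \<le> N" "\<And>z gs. dlt (F z) gs = 0"
  obtains \<psi> where "cell k1 k2 s (N - 1) \<psi>" "\<And>z gs. dlt (\<psi> z) gs = F z gs"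
\<comment> \<open>The two group elements that carry the cell at \<open>(0, 0)\<close> to the cell at
  \<open>z\<close>: a translation, and a point reflection corrected by the side lengths because it
  sends the lower left corner to the upper right one.\<close>
proof (rule finite_stabiliser_acyclic [OF assms(1,2), where S = UNIV
      and \<gamma> = "\<lambda>(z1, z2). (z1, z2, False)" and \<gamma>' = "\<lambda>(z1, z2). (z1 + k1, z2 + k2, True)"])
  fix h :: mon and z :: "int \<times> int"
  show "((case cact k1 k2 h z of (z1, z2) \<Rightarrow> (z1, z2, False)) = gmul h (case z of (z1, z2) \<Rightarrow> (z1, z2, False)) \<and>
       (case cact k1 k2 h z of (z1, z2) \<Rightarrow> (z1 + k1, z2 + k2, True)) = gmul h (case z of (z1, z2) \<Rightarrow> (z1 + k1, z2 + k2, True))) \<or>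
      ((case cact k1 k2 h z of (z1, z2) \<Rightarrow> (z1, z2, False)) = gmul h (case z of (z1, z2) \<Rightarrow> (z1 + k1, z2 + k2, True)) \<and>
       (case cact k1 k2 h z of (z1, z2) \<Rightarrow> (z1 + k1, z2 + k2, True)) = gmul h (case z of (z1, z2) \<Rightarrow> (z1, z2, False)))"
    by (cases h; cases z) (auto simp: sg_def)
qed (use assms(3) that in auto)

definition dif1 :: "(int \<times> int \<Rightarrow> mon list \<Rightarrow> complex) \<Rightarrow> int \<times> int \<Rightarrow> mon list \<Rightarrow> complex" where
  "dif1 F z gs = F (fst z + 1, snd z) gs - F z gs"

definition dif2 :: "(int \<times> int \<Rightarrow> mon list \<Rightarrow> complex) \<Rightarrow> int \<times> int \<Rightarrow> mon list \<Rightarrow> complex" where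
  "dif2 F z gs = F (fst z, snd z + 1) gs - F z gs"

text \<open>A point reflection exchanges the two ends of a unit step, which reverses the orientation
  sign and moves the lower left corner by one.\<close>

lemma cell_dif1:
  assumes F: "cell 0 k2 s N F"
  shows "cell 1 k2 (- s) N (dif1 F)"
proof (rule cellI)
  fix n m z1 z2 gs
  show "dif1 F (n + z1, m + z2) (map (gmul (n, m, False)) gs) = dif1 F (z1, z2) gs"
    using cell_translate [OF F, of n "z1 + 1" m z2 gs] cell_translate [OF F, of n z1 m z2 gs]
    by (simp add: dif1_def add.assoc)
  show "dif1 F (n - z1 - 1, m - z2 - k2) (map (gmul (n, m, True)) gs) = - s * dif1 F (z1, z2) gs"
    using cell_reflect [OF F, of n "z1 + 1" m z2 gs] cell_reflect [OF F, of n z1 m z2 gs]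
    by (simp add: dif1_def algebra_simps)
qed (simp add: dif1_def ecoch_length [OF F])

lemma cell_dif2:
  assumes F: "cell k1 0 s N F"
  shows "cell k1 1 (- s) N (dif2 F)"
proof (rule cellI)
  fix n m z1 z2 gs
  show "dif2 F (n + z1, m + z2) (map (gmul (n, m, False)) gs) = dif2 F (z1, z2) gs"
    using cell_translate [OF F, of n z1 m "z2 + 1" gs] cell_translate [OF F, of n z1 m z2 gs]
    by (simp add: dif2_def add.assoc)
  show "dif2 F (n - z1 - k1, m - z2 - 1) (map (gmul (n, m, True)) gs) = - s * dif2 F (z1, z2) gs"
    using cell_reflect [OF F, of n z1 m "z2 + 1" gs] cell_reflect [OF F, of n z1 m z2 gs]
    by (simp add: dif2_def algebra_simps)
qed (simp add: dif2_def ecoch_length [OF F])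

section \<open>Discrete integration on the grid\<close>

lemma int_constant:
  fixes h :: "int \<Rightarrow> complex"
  assumes "\<And>z. h (z + 1) = h z"
  shows "h z = h b"
proof (induction z rule: int_induct [of _ b])
  case (step2 i)
  then show ?case using assms [of "i - 1"] by simp
qed (simp_all add: assms)

lemma int_antiderivative:
  fixes p :: "int \<Rightarrow> complex"
  obtains h where "h b = 0" "\<And>z. h (z + 1) - h z = p z"
proof -
  define h where "h = (\<lambda>z. if z \<ge> b then (\<Sum>i<nat (z - b). p (b + int i)) else - (\<Sum>i<nat (b - z). p (b - 1 - int i)))"
  have "h (z + 1) - h z = p z" for z
  proof -
    consider "z \<ge> b" | "z + 1 = b" | "z + 1 < b" by linarith
    then show ?thesis
    proof cases
      case 1
      then have "nat (z + 1 - b) = Suc (nat (z - b))" by simp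
      then show ?thesis using 1 by (simp add: h_def)
    next
      case 2
      then have "b = z + 1" by simp
      then show ?thesis by (simp add: h_def)
    next
      case 3
      then have "nat (b - z) = Suc (nat (b - (z + 1)))" by simp
      then show ?thesis using 3 by (simp add: h_def)
    qed
  qed
  moreover have "h b = 0" by (simp add: h_def)
  ultimately show thesis using that by blast
qed

lemma grid_constant:
  fixes u :: "int \<times> int \<Rightarrow> complex"
  assumes "\<And>z1 z2. u (z1 + 1, z2) = u (z1, z2)" "\<And>z1 z2. u (z1, z2 + 1) = u (z1, z2)"
  shows "u z = u b"
proof -
  obtain z1 z2 b1 b2 where z: "z = (z1, z2)" "b = (b1, b2)" by (cases z; cases b)
  have "u (z1, z2) = u (b1, z2)" using int_constant [of "\<lambda>i. u (i, z2)"] assms by blast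
  also have "\<dots> = u (b1, b2)" using int_constant [of "\<lambda>i. u (b1, i)"] assms by blast
  finally show ?thesis by (simp add: z)
qed

text \<open>The discrete Poincare lemma: integrate along the row through \<open>b\<close>, then
  along each column. By \<open>closed\<close>, the error in the row direction is constant along
  columns, so it can be evaluated on the base row.\<close>

lemma grid_potential:
  fixes p q :: "int \<times> int \<Rightarrow> complex"
  assumes closed: "\<And>z1 z2. q (z1 + 1, z2) - q (z1, z2) = p (z1, z2 + 1) - p (z1, z2)"
  shows "\<exists>h. h b = 0 \<and> (\<forall>z1 z2. h (z1 + 1, z2) - h (z1, z2) = p (z1, z2)) \<and>
    (\<forall>z1 z2. h (z1, z2 + 1) - h (z1, z2) = q (z1, z2))"
proof -
  obtain b1 b2 where b: "b = (b1, b2)" by (cases b)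
  obtain h1 where h1: "h1 b1 = 0" "\<And>z. h1 (z + 1) - h1 z = p (z, b2)"
    using int_antiderivative [of b1 "\<lambda>z. p (z, b2)"] by metis
  have "\<exists>h. h b2 = 0 \<and> (\<forall>z. h (z + 1) - h z = q (z1, z))" for z1
    using int_antiderivative [of b2 "\<lambda>z. q (z1, z)"] by metis
  then obtain h2 where h2: "\<And>z1. h2 z1 b2 = 0" "\<And>z1 z. h2 z1 (z + 1) - h2 z1 z = q (z1, z)"
    by metis
  have "p (z1, z2) - h2 (z1 + 1) z2 + h2 z1 z2 = p (z1, b2) - h2 (z1 + 1) b2 + h2 z1 b2" for z1 z2
  proof (rule int_constant [of "\<lambda>z2. p (z1, z2) - h2 (z1 + 1) z2 + h2 z1 z2"])
    fix z
    show "p (z1, z + 1) - h2 (z1 + 1) (z + 1) + h2 z1 (z + 1) = p (z1, z) - h2 (z1 + 1) z + h2 z1 z"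
      using closed [of z1 z] h2(2) [of z1 z] h2(2) [of "z1 + 1" z] by algebra
  qed
  then have *: "p (z1, z2) = p (z1, b2) + h2 (z1 + 1) z2 - h2 z1 z2" for z1 z2
    by (simp add: h2 algebra_simps)
  show ?thesis
  proof (intro exI conjI allI)
    show "(\<lambda>(z1, z2). h1 z1 + h2 z1 z2) b = 0" by (simp add: b h1 h2)
    fix z1 z2
    show "(\<lambda>(z1, z2). h1 z1 + h2 z1 z2) (z1 + 1, z2) - (\<lambda>(z1, z2). h1 z1 + h2 z1 z2) (z1, z2) = p (z1, z2)"
      unfolding * [of z1 z2] h1(2) [symmetric] by simp
    show "(\<lambda>(z1, z2). h1 z1 + h2 z1 z2) (z1, z2 + 1) - (\<lambda>(z1, z2). h1 z1 + h2 z1 z2) (z1, z2) = q (z1, z2)"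
      by (simp add: h2(2) [symmetric])
  qed
qed

definition corner :: "mon \<Rightarrow> int \<times> int" where "corner g = (fst g, fst (snd g))"

lemma corner_gmul: "corner (gmul (n, m, e) g) = (n + sg e * fst (corner g), m + sg e * snd (corner g))"
  by (cases g) (simp add: corner_def)

text \<open>Normalising potentials to vanish at the vertex below the first group element makes them
  equivariant.\<close>

lemma cell_potential:
  assumes P: "cell 1 0 (-1) N P" and Q: "cell 0 1 (-1) N Q" and "1 \<le> N"
    and closed: "\<And>z gs. dif1 Q z gs = dif2 P z gs"
  obtains H where "cell 0 0 1 N H" "\<And>z gs. dif1 H z gs = P z gs" "\<And>z gs. dif2 H z gs = Q z gs"
proof -
  have "\<exists>h. h (corner (hd gs)) = 0 \<and> (\<forall>z1 z2. h (z1 + 1, z2) - h (z1, z2) = P (z1, z2) gs) \<and>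
      (\<forall>z1 z2. h (z1, z2 + 1) - h (z1, z2) = Q (z1, z2) gs)" for gs
  proof (rule grid_potential)
    fix z1 z2
    show "Q (z1 + 1, z2) gs - Q (z1, z2) gs = P (z1, z2 + 1) gs - P (z1, z2) gs"
      using closed [of "(z1, z2)" gs] by (simp add: dif1_def dif2_def)
  qed
  then obtain h where h0: "\<And>gs. h gs (corner (hd gs)) = 0"
    and h1: "\<And>gs z1 z2. h gs (z1 + 1, z2) - h gs (z1, z2) = P (z1, z2) gs"
    and h2: "\<And>gs z1 z2. h gs (z1, z2 + 1) - h gs (z1, z2) = Q (z1, z2) gs"
    by metis
  define H where "H = (\<lambda>z gs. if length gs = N then h gs z else 0)"
  have "cell 0 0 1 N H"
  proof (rule cellI)
    fix n m z1 z2 gs assume len: "length (gs :: mon list) = N"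
    then have "gs \<noteq> []" using \<open>1 \<le> N\<close> by auto
    then have hd: "hd (map (gmul g) gs) = gmul g (hd gs)" for g by (simp add: hd_map)
    define b where "b = corner (hd gs)"
    \<comment> \<open>Both potentials have the same increments, so they differ by a constant; at
      \<open>b\<close> both are normalised to zero. The same is done for reflections with
      \<open>v\<close>.\<close>
    define u where "u = (\<lambda>(z1, z2). h (map (gmul (n, m, False)) gs) (n + z1, m + z2) - h gs (z1, z2))"
    have "u (z1, z2) = u b"
    proof (rule grid_constant)
      fix z1 z2
      show "u (z1 + 1, z2) = u (z1, z2)"
        using h1 [of "map (gmul (n, m, False)) gs" "n + z1" "m + z2"] h1 [of gs z1 z2]
          cell_translate [OF P, of n z1 m z2 gs]
        by (simp add: u_def algebra_simps)
      show "u (z1, z2 + 1) = u (z1, z2)"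
        using h2 [of "map (gmul (n, m, False)) gs" "n + z1" "m + z2"] h2 [of gs z1 z2]
          cell_translate [OF Q, of n z1 m z2 gs]
        by (simp add: u_def algebra_simps)
    qed
    also have "u b = 0"
      using h0 [of "map (gmul (n, m, False)) gs"] h0 [of gs]
      unfolding hd corner_gmul b_def [symmetric] by (simp add: u_def sg_def split_beta)
    finally show "H (n + z1, m + z2) (map (gmul (n, m, False)) gs) = H (z1, z2) gs"
      by (simp add: u_def H_def len)
    define v where "v = (\<lambda>(z1, z2). h (map (gmul (n, m, True)) gs) (n - z1, m - z2) - h gs (z1, z2))"
    have "v (z1, z2) = v b"
    proof (rule grid_constant)
      fix z1 z2
      show "v (z1 + 1, z2) = v (z1, z2)"
        using h1 [of "map (gmul (n, m, True)) gs" "n - z1 - 1" "m - z2"] h1 [of gs z1 z2]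
          cell_reflect [OF P, of n z1 m z2 gs]
        by (simp add: v_def algebra_simps)
      show "v (z1, z2 + 1) = v (z1, z2)"
        using h2 [of "map (gmul (n, m, True)) gs" "n - z1" "m - z2 - 1"] h2 [of gs z1 z2]
          cell_reflect [OF Q, of n z1 m z2 gs]
        by (simp add: v_def algebra_simps)
    qed
    also have "v b = 0"
      using h0 [of "map (gmul (n, m, True)) gs"] h0 [of gs]
      unfolding hd corner_gmul b_def [symmetric] by (simp add: v_def sg_def split_beta)
    finally show "H (n - z1 - 0, m - z2 - 0) (map (gmul (n, m, True)) gs) = 1 * H (z1, z2) gs"
      by (simp add: v_def H_def len)
  qed (simp add: H_def)
  moreover have "dif1 H z gs = P z gs" "dif2 H z gs = Q z gs" for z gs
    using h1 [of gs "fst z" "snd z"] h2 [of gs "fst z" "snd z"]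
      ecoch_length [OF P, of gs z] ecoch_length [OF Q, of gs z]
    by (auto simp: dif1_def dif2_def H_def)
  ultimately show thesis using that by blast
qed

text \<open>The plane has no second cohomology, and vertical edges alone provide a primitive: each
  row is summed starting from the column of the first group element, a starting point that moves
  along with the group.\<close>

lemma cell_antiderivative:
  assumes R: "cell 1 1 1 N R" and "1 \<le> N"
  obtains Q where "cell 0 1 (-1) N Q" "\<And>z gs. dif1 Q z gs = R z gs"
proof -
  have "\<exists>h. h (fst (corner (hd gs))) = 0 \<and> (\<forall>z1. h (z1 + 1) - h z1 = R (z1, z2) gs)" for gs z2
    using int_antiderivative [of "fst (corner (hd gs))" "\<lambda>z1. R (z1, z2) gs"] by metis
  then obtain h where h0: "\<And>gs z2. h gs z2 (fst (corner (hd gs))) = 0"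
    and h1: "\<And>gs z1 z2. h gs z2 (z1 + 1) - h gs z2 z1 = R (z1, z2) gs"
    by metis
  define Q where "Q = (\<lambda>z gs. if length gs = N then h gs (snd z) (fst z) else 0)"
  have "cell 0 1 (-1) N Q"
  proof (rule cellI)
    fix n m z1 z2 gs assume len: "length (gs :: mon list) = N"
    then have "gs \<noteq> []" using \<open>1 \<le> N\<close> by auto
    then have hd: "hd (map (gmul g) gs) = gmul g (hd gs)" for g by (simp add: hd_map)
    define b where "b = fst (corner (hd gs))"
    have "h (map (gmul (n, m, False)) gs) (m + z2) (n + z1) - h gs z2 z1
        = h (map (gmul (n, m, False)) gs) (m + z2) (n + b) - h gs z2 b"
    proof (rule int_constant [of "\<lambda>z1. h (map (gmul (n, m, False)) gs) (m + z2) (n + z1) - h gs z2 z1"])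
      fix z1
      show "h (map (gmul (n, m, False)) gs) (m + z2) (n + (z1 + 1)) - h gs z2 (z1 + 1)
        = h (map (gmul (n, m, False)) gs) (m + z2) (n + z1) - h gs z2 z1"
        using h1 [of "map (gmul (n, m, False)) gs" "m + z2" "n + z1"] h1 [of gs z2 z1]
          cell_translate [OF R, of n z1 m z2 gs]
        by (simp add: algebra_simps)
    qed
    also have "\<dots> = 0"
      using h0 [of "map (gmul (n, m, False)) gs"] h0 [of gs]
      unfolding hd corner_gmul b_def [symmetric] by (simp add: sg_def b_def)
    finally show "Q (n + z1, m + z2) (map (gmul (n, m, False)) gs) = Q (z1, z2) gs"
      by (simp add: Q_def len)
    have "h (map (gmul (n, m, True)) gs) (m - z2 - 1) (n - z1) + h gs z2 z1
        = h (map (gmul (n, m, True)) gs) (m - z2 - 1) (n - b) + h gs z2 b"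
    proof (rule int_constant [of "\<lambda>z1. h (map (gmul (n, m, True)) gs) (m - z2 - 1) (n - z1) + h gs z2 z1"])
      fix z1
      show "h (map (gmul (n, m, True)) gs) (m - z2 - 1) (n - (z1 + 1)) + h gs z2 (z1 + 1)
        = h (map (gmul (n, m, True)) gs) (m - z2 - 1) (n - z1) + h gs z2 z1"
        using h1 [of "map (gmul (n, m, True)) gs" "m - z2 - 1" "n - z1 - 1"] h1 [of gs z2 z1]
          cell_reflect [OF R, of n z1 m z2 gs]
        by (simp add: algebra_simps)
    qed
    also have "\<dots> = 0"
      using h0 [of "map (gmul (n, m, True)) gs"] h0 [of gs]
      unfolding hd corner_gmul b_def [symmetric] by (simp add: sg_def b_def)
    finally show "Q (n - z1 - 0, m - z2 - 1) (map (gmul (n, m, True)) gs) = - 1 * Q (z1, z2) gs"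
      by (simp add: Q_def len add_eq_0_iff)
  qed (simp add: Q_def)
  moreover have "dif1 Q z gs = R z gs" for z gs
    using h1 [of gs "snd z" "fst z"] ecoch_length [OF R, of gs z]
    by (auto simp: dif1_def Q_def)
  ultimately show thesis using that by blast
qed

lemma cell_constant:
  assumes F: "cell 0 0 1 N F" and "\<And>z gs. dif1 F z gs = 0" "\<And>z gs. dif2 F z gs = 0"
  obtains \<psi> where "pcoch N \<psi>" "\<And>z. F z = \<psi>"
proof
  have const: "F z gs = F (0, 0) gs" for z gs
  proof (rule grid_constant [of "\<lambda>z. F z gs"])
    fix z1 z2
    show "F (z1 + 1, z2) gs = F (z1, z2) gs" "F (z1, z2 + 1) gs = F (z1, z2) gs"
      using assms(2,3) [of "(z1, z2)" gs] by (simp_all add: dif1_def dif2_def)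
  qed
  have "F (0, 0) (map (gmul h) gs) = F (0, 0) gs" for h gs
    using ecoch_act [OF F, of h "(0, 0)" gs] const [of "cact 0 0 h (0, 0)" "map (gmul h) gs"]
    by (cases h) (simp split: if_splits)
  then show "pcoch N (F (0, 0))" using ecoch_length [OF F] by (simp add: pcoch_def)
  show "F z = F (0, 0)" for z using const by blast
qed

section \<open>Group cohomology through vertices, edges and squares\<close>

lemma dlt_dif1: "dlt (dif1 F z) gs = dif1 (\<lambda>z. dlt (F z)) z gs"
  by (simp add: dif1_def [abs_def] dlt_diff)

lemma dlt_dif2: "dlt (dif2 F z) gs = dif2 (\<lambda>z. dlt (F z)) z gs"
  by (simp add: dif2_def [abs_def] dlt_diff)

lemma dif1_dif2: "dif1 (dif2 F) z gs = dif2 (dif1 F) z gs"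
  by (simp add: dif1_def dif2_def)

lemma cell_const_pcoch: "pcoch N f \<Longrightarrow> cell 0 0 1 N (\<lambda>_. f)"
  by (rule cellI) (simp_all add: pcoch_def del: gmul.simps)

text \<open>Regarded as a constant function of the vertices, a cocycle becomes a coboundary because
  vertices have stabilisers of order 2. The primitive \<open>F\<close> in general depends on the
  vertex, and the obstruction is carried by its differences.\<close>

lemma point_lift:
  assumes "pcoch N f" "2 \<le> N" "\<And>gs. dlt f gs = 0"
  obtains F where "cell 0 0 1 (N - 1) F" "\<And>z gs. dlt (F z) gs = f gs"
  using cell_acyclic [OF cell_const_pcoch [OF assms(1)] assms(2)] assms(3) by metis

text \<open>A zigzag through the double complex of cochains on vertices, edges and squares; the only
  obstruction to trivialising \<open>f\<close> is the square function \<open>dif1 Q - dif2 P\<close>.\<close>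

lemma point_zigzag:
  assumes F: "cell 0 0 1 (Suc M) F" and P: "cell 1 0 (-1) M P" and Q: "cell 0 1 (-1) M Q"
    and "1 \<le> M"
    and F_f: "\<And>z gs. dlt (F z) gs = f gs"
    and P_F: "\<And>z gs. dlt (P z) gs = dif1 F z gs" and Q_F: "\<And>z gs. dlt (Q z) gs = dif2 F z gs"
    and closed: "\<And>z gs. dif1 Q z gs = dif2 P z gs"
  obtains \<psi> where "pcoch (Suc M) \<psi>" "\<And>gs. dlt \<psi> gs = f gs"
proof -
  obtain H where H: "cell 0 0 1 M H" "\<And>z gs. dif1 H z gs = P z gs" "\<And>z gs. dif2 H z gs = Q z gs"
    using cell_potential [OF P Q \<open>1 \<le> M\<close> closed] by blast
  have eq: "dif1 H z = P z" "dif2 H z = Q z" for z using H(2,3) by (intro ext; blast)+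
  \<comment> \<open>Subtracting \<open>dlt H\<close> keeps the coboundary of \<open>F\<close> and
    removes its dependence on the vertex, so a cochain of the group itself is left.\<close>
  define G where "G = (\<lambda>z gs. F z gs - dlt (H z) gs)"
  have G: "cell 0 0 1 (Suc M) G" unfolding G_def by (intro ecoch_diff F ecoch_dlt H(1))
  have "dif1 G z gs = 0" "dif2 G z gs = 0" for z gs
    using P_F [of z gs] Q_F [of z gs]
    unfolding eq [symmetric] dlt_dif1 dlt_dif2 by (simp_all add: G_def dif1_def dif2_def algebra_simps)
  then obtain \<psi> where \<psi>: "pcoch (Suc M) \<psi>" "\<And>z. G z = \<psi>"
    using cell_constant [OF G] by metis
  have "dlt \<psi> gs = f gs" for gs
    unfolding \<psi>(2) [of "(0, 0)", symmetric] G_def by (simp add: dlt_diff F_f)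
  then show thesis using \<psi>(1) that by blast
qed

text \<open>Averaging gives a primitive with one group element fewer, and \<open>dif1\<close>,
  \<open>dif2\<close> pass to cells one dimension higher. The square function is again a cocycle
  because these differences commute with \<open>dlt\<close> and with each other.\<close>

lemma point_squares:
  assumes "pcoch N f" "3 \<le> N" "\<And>gs. dlt f gs = 0"
  obtains F P Q where "cell 0 0 1 (N - 1) F" "cell 1 0 (-1) (N - 2) P" "cell 0 1 (-1) (N - 2) Q"
    "\<And>z gs. dlt (F z) gs = f gs"
    "\<And>z gs. dlt (P z) gs = dif1 F z gs" "\<And>z gs. dlt (Q z) gs = dif2 F z gs"
    "cell 1 1 1 (N - 2) (\<lambda>z gs. dif1 Q z gs - dif2 P z gs)"
    "\<And>z gs. dlt (\<lambda>gs. dif1 Q z gs - dif2 P z gs) gs = 0"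
proof -
  obtain F where F: "cell 0 0 1 (N - 1) F" "\<And>z gs. dlt (F z) gs = f gs"
    using point_lift [OF assms(1)] assms(2,3) by auto
  have 2: "2 \<le> N - 1" "N - 1 - 1 = N - 2" using assms(2) by auto
  have "dlt (dif1 F z) gs = 0" "dlt (dif2 F z) gs = 0" for z gs
    by (simp_all add: dlt_dif1 dlt_dif2 F(2) dif1_def dif2_def)
  then obtain P Q where P: "cell 1 0 (-1) (N - 2) P" "\<And>z gs. dlt (P z) gs = dif1 F z gs"
    and Q: "cell 0 1 (-1) (N - 2) Q" "\<And>z gs. dlt (Q z) gs = dif2 F z gs"
    using cell_acyclic [OF cell_dif1 [OF F(1)] 2(1)] cell_acyclic [OF cell_dif2 [OF F(1)] 2(1)]
    unfolding 2(2) by metis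
  have "cell 1 1 1 (N - 2) (dif1 Q)" "cell 1 1 1 (N - 2) (dif2 P)"
    using cell_dif1 [OF Q(1)] cell_dif2 [OF P(1)] by simp_all
  then have R: "cell 1 1 1 (N - 2) (\<lambda>z gs. dif1 Q z gs - dif2 P z gs)" by (rule ecoch_diff)
  have eq: "(\<lambda>z. dlt (P z)) = dif1 F" "(\<lambda>z. dlt (Q z)) = dif2 F"
    using P(2) Q(2) by (intro ext; blast)+
  have "dlt (\<lambda>gs. dif1 Q z gs - dif2 P z gs) gs = 0" for z gs
    by (simp add: dlt_diff dlt_dif1 dlt_dif2 eq dif1_dif2)
  then show thesis by (rule that [OF F(1) P(1) Q(1) F(2) P(2) Q(2) R])
qed

text \<open>For \<open>4 \<le> N\<close> the square function still has at least two group arguments,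
  so averaging gives it a primitive \<open>S\<close>; a horizontal antiderivative \<open>Q'\<close>
  of \<open>S\<close> then absorbs the obstruction into \<open>Q\<close>.\<close>

lemma point_exact_high:
  assumes "pcoch N f" "4 \<le> N" "\<And>gs. dlt f gs = 0"
  obtains \<psi> where "pcoch (N - 1) \<psi>" "\<And>gs. dlt \<psi> gs = f gs"
proof -
  have N: "3 \<le> N" "2 \<le> N - 2" "Suc (N - 2) = N - 1" "1 \<le> N - 2" "1 \<le> N - 2 - 1" "Suc (N - 2 - 1) = N - 2"
    using assms(2) by auto
  obtain F P Q where F: "cell 0 0 1 (N - 1) F" and P: "cell 1 0 (-1) (N - 2) P" and Q: "cell 0 1 (-1) (N - 2) Q"
    and F_f: "\<And>z gs. dlt (F z) gs = f gs"
    and P_F: "\<And>z gs. dlt (P z) gs = dif1 F z gs" and Q_F: "\<And>z gs. dlt (Q z) gs = dif2 F z gs"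
    and R: "cell 1 1 1 (N - 2) (\<lambda>z gs. dif1 Q z gs - dif2 P z gs)"
    and R0: "\<And>z gs. dlt (\<lambda>gs. dif1 Q z gs - dif2 P z gs) gs = 0"
    using point_squares [OF assms(1) N(1) assms(3)] by blast
  obtain S where S: "cell 1 1 1 (N - 2 - 1) S" "\<And>z gs. dlt (S z) gs = dif1 Q z gs - dif2 P z gs"
    using cell_acyclic [OF R N(2) R0] by blast
  obtain Q' where Q': "cell 0 1 (-1) (N - 2 - 1) Q'" "\<And>z gs. dif1 Q' z gs = S z gs"
    using cell_antiderivative [OF S(1) N(5)] by blast
  define Q1 where "Q1 = (\<lambda>z gs. Q z gs - dlt (Q' z) gs)"
  have Q1: "cell 0 1 (-1) (N - 2) Q1"
    unfolding Q1_def using ecoch_diff [OF Q ecoch_dlt [OF Q'(1), unfolded N(6)]] .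
  have S': "dif1 Q' z = S z" for z using Q'(2) by (intro ext)
  have "dif1 Q1 z gs = dif2 P z gs" for z gs
    using S(2) [of z gs] unfolding S' [symmetric] dlt_dif1
    by (simp add: Q1_def dif1_def algebra_simps)
  moreover have "dlt (Q1 z) gs = dif2 F z gs" for z gs
    by (simp add: Q1_def dlt_diff Q_F)
  ultimately show thesis
    using point_zigzag [OF _ P Q1 N(4), of F f] F F_f P_F that unfolding N(3) by metis
qed

lemma dlt_singleton_const:
  assumes "\<And>gs. dlt f gs = 0"
  shows "f [g] = f [h]"
  using assms [of "[h, g]"] by simp

text \<open>The edge differences of \<open>F\<close> have one group argument and are cocycles, hence
  independent of it. Reflection in the midpoint of the edge changes their sign, so they vanish and
  \<open>F\<close> does not depend on the vertex.\<close>

lemma point_exact_1: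
  assumes "pcoch 2 f" "\<And>gs. dlt f gs = 0"
  obtains \<psi> where "pcoch 1 \<psi>" "\<And>gs. dlt \<psi> gs = f gs"
proof -
  obtain F where F: "cell 0 0 1 1 F" "\<And>z gs. dlt (F z) gs = f gs"
    using point_lift [OF assms(1)] assms(2) by auto
  have vanish: "G (z1, z2) gs = 0"
    if G: "cell k1 k2 (-1) 1 G" and dG: "\<And>z gs. dlt (G z) gs = 0" for G k1 k2 z1 z2 gs
  proof (cases "length gs = 1")
    case True
    then obtain g where gs: "gs = [g]" by (auto simp: length_Suc_conv)
    show ?thesis
      \<comment> \<open>The reflection \<open>(2 * z1 + k1, 2 * z2 + k2, True)\<close> is the one
        about the centre of the cell, so it fixes \<open>(z1, z2)\<close>.\<close>
      using cell_reflect [OF G, of "2 * z1 + k1" z1 "2 * z2 + k2" z2 gs]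
        dlt_singleton_const [OF dG, of "(z1, z2)" g "gmul (2 * z1 + k1, 2 * z2 + k2, True) g"]
      by (simp add: gs)
  qed (use ecoch_length [OF G] in auto)
  have d: "dlt (dif1 F z) gs = 0" "dlt (dif2 F z) gs = 0" for z gs
    by (simp_all add: dlt_dif1 dlt_dif2 F(2) dif1_def dif2_def)
  have "dif1 F z gs = 0" "dif2 F z gs = 0" for z gs
    using vanish [OF cell_dif1 [OF F(1)] d(1)] vanish [OF cell_dif2 [OF F(1)] d(2)]
    by (cases z; simp)+
  then obtain \<psi> where "pcoch 1 \<psi>" "\<And>z. F z = \<psi>"
    using cell_constant [OF F(1)] by metis
  then show thesis using F(2) that by metis
qed

text \<open>Twice the signed area of the triangle of translation parts. It is invariant because the
  linear parts \<open>1\<close> and \<open>-1\<close> have determinant 1 in the plane.\<close>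

definition area :: "mon list \<Rightarrow> complex" where
  "area gs = (if length gs = 3 then of_int
     ((fst (gs ! 1) - fst (gs ! 0)) * (fst (snd (gs ! 2)) - fst (snd (gs ! 0))) -
      (fst (snd (gs ! 1)) - fst (snd (gs ! 0))) * (fst (gs ! 2) - fst (gs ! 0))) else 0)"

lemma area_3: "area [(a1, a2, e), (b1, b2, f), (c1, c2, g)] = of_int ((b1 - a1) * (c2 - a2) - (b2 - a2) * (c1 - a1))"
  by (simp add: area_def)

lemma length_3E:
  assumes "length gs = 3"
  obtains a1 a2 e b1 b2 f c1 c2 g where "gs = [(a1, a2, e), (b1, b2, f), (c1, c2, g)]"
proof -
  obtain x y z :: "'a \<times> 'b \<times> 'c" where "gs = [x, y, z]"
    using assms by (auto simp: numeral_3_eq_3 length_Suc_conv)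
  then show thesis using that by (cases x; cases y; cases z) auto
qed

lemma pcoch_area: "pcoch 3 area"
  unfolding pcoch_def
proof (intro conjI allI impI)
  fix h :: mon and gs :: "mon list"
  show "area (map (gmul h) gs) = area gs"
  proof (cases "length gs = 3")
    case True
    then show ?thesis
      by (cases h; elim length_3E) (auto simp: area_3 sg_def algebra_simps)
  qed (simp add: area_def)
qed (simp add: area_def)

lemma dlt_area: "dlt area gs = 0"
proof (cases "length gs = 4")
  case True
  then obtain x xs where gs: "gs = x # xs" "length xs = 3" by (auto simp: length_Suc_conv numeral_eq_Suc)
  show ?thesis
    using gs(2) unfolding gs(1)
    by (cases x; elim length_3E) (simp add: area_3, simp add: algebra_simps)
next
  case False
  then have "dlt area gs = dlt (\<lambda>_. 0) gs" by (intro dlt_cong) (simp add: area_def)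
  then show ?thesis by simp
qed

definition area_F :: "int \<times> int \<Rightarrow> mon list \<Rightarrow> complex" where
  "area_F z gs = area ((fst z, snd z, False) # gs)"

definition area_P :: "int \<times> int \<Rightarrow> mon list \<Rightarrow> complex" where
  "area_P z gs = (if length gs = 1 then of_int (snd z - fst (snd (gs ! 0))) else 0)"

definition area_Q :: "int \<times> int \<Rightarrow> mon list \<Rightarrow> complex" where
  "area_Q z gs = (if length gs = 1 then of_int (fst (gs ! 0) - fst z) else 0)"

text \<open>An explicit zigzag for \<open>area\<close>, starting from the cone with vertex
  \<open>z\<close>. It ends in the constant square function \<open>-2\<close>, against which a
  general cocycle is compared.\<close>

lemma area_zigzag:
  shows "cell 0 0 1 2 area_F" "cell 1 0 (-1) 1 area_P" "cell 0 1 (-1) 1 area_Q"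
    "dlt (area_F z) gs = area gs" "dlt (area_P z) gs = dif1 area_F z gs" "dlt (area_Q z) gs = dif2 area_F z gs"
    "length gs = 1 \<Longrightarrow> dif1 area_Q z gs - dif2 area_P z gs = -2"
proof -
  have F_eq: "area_F (z1, z2) [(b1, b2, f), (c1, c2, g)] = of_int ((b1 - z1) * (c2 - z2) - (b2 - z2) * (c1 - z1))"
    for z1 z2 b1 b2 f c1 c2 g by (simp add: area_F_def area_3)
  have F0: "length gs \<noteq> 2 \<Longrightarrow> area_F z gs = 0" for z gs by (simp add: area_F_def area_def)
  have two: "\<exists>b1 b2 f c1 c2 g. gs = [(b1, b2, f), (c1, c2, g)]" if "length gs = 2" for gs :: "mon list"
    using that by (auto simp: numeral_2_eq_2 length_Suc_conv)
  show "cell 0 0 1 2 area_F"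
  proof (rule cellI)
    fix n m z1 z2 and gs :: "mon list" assume "length gs = 2"
    then obtain b1 b2 f c1 c2 g where gs: "gs = [(b1, b2, f), (c1, c2, g)]" using two by blast
    show "area_F (n + z1, m + z2) (map (gmul (n, m, False)) gs) = area_F (z1, z2) gs"
      "area_F (n - z1 - 0, m - z2 - 0) (map (gmul (n, m, True)) gs) = 1 * area_F (z1, z2) gs"
      by (simp_all add: gs F_eq sg_def algebra_simps)
  qed (rule F0)
  have one: "\<exists>b1 b2 f. gs = [(b1, b2, f)]" if "length gs = 1" for gs :: "mon list"
    using that by (auto simp: length_Suc_conv)
  show "cell 1 0 (-1) 1 area_P"
  proof (rule cellI)
    fix n m z1 z2 and gs :: "mon list" assume "length gs = 1"
    then obtain b1 b2 f where gs: "gs = [(b1, b2, f)]" using one by blast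
    show "area_P (n + z1, m + z2) (map (gmul (n, m, False)) gs) = area_P (z1, z2) gs"
      "area_P (n - z1 - 1, m - z2 - 0) (map (gmul (n, m, True)) gs) = - 1 * area_P (z1, z2) gs"
      by (simp_all add: gs area_P_def sg_def)
  qed (simp add: area_P_def)
  show "cell 0 1 (-1) 1 area_Q"
  proof (rule cellI)
    fix n m z1 z2 and gs :: "mon list" assume "length gs = 1"
    then obtain b1 b2 f where gs: "gs = [(b1, b2, f)]" using one by blast
    show "area_Q (n + z1, m + z2) (map (gmul (n, m, False)) gs) = area_Q (z1, z2) gs"
      "area_Q (n - z1 - 0, m - z2 - 1) (map (gmul (n, m, True)) gs) = - 1 * area_Q (z1, z2) gs"
      by (simp_all add: gs area_Q_def sg_def)
  qed (simp add: area_Q_def)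
  show "dlt (area_F z) gs = area gs"
    using dlt_area [of "(fst z, snd z, False) # gs"] by (simp add: area_F_def [abs_def])
  show "dlt (area_P z) gs = dif1 area_F z gs"
  proof (cases "length gs = 2")
    case True
    then obtain b1 b2 f c1 c2 g where "gs = [(b1, b2, f), (c1, c2, g)]" using two by blast
    then show ?thesis by (cases z) (simp add: area_P_def dif1_def F_eq algebra_simps)
  next
    case False
    then have "dlt (area_P z) gs = dlt (\<lambda>_. 0) gs" by (intro dlt_cong) (simp add: area_P_def)
    then show ?thesis using False by (simp add: dif1_def F0)
  qed
  show "dlt (area_Q z) gs = dif2 area_F z gs"
  proof (cases "length gs = 2")
    case True
    then obtain b1 b2 f c1 c2 g where "gs = [(b1, b2, f), (c1, c2, g)]" using two by blast
    then show ?thesis by (cases z) (simp add: area_Q_def dif2_def F_eq algebra_simps)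
  next
    case False
    then have "dlt (area_Q z) gs = dlt (\<lambda>_. 0) gs" by (intro dlt_cong) (simp add: area_Q_def)
    then show ?thesis using False by (simp add: dif2_def F0)
  qed
  show "length gs = 1 \<Longrightarrow> dif1 area_Q z gs - dif2 area_P z gs = -2"
    by (simp add: area_P_def area_Q_def dif1_def dif2_def)
qed

text \<open>Here the square function has a single group argument. The cocycle condition makes it
  independent of that argument and translations make it equal on all squares: one number remains,
  and a multiple of \<open>area\<close> cancels it.\<close>

lemma point_H2:
  assumes "pcoch 3 f" "\<And>gs. dlt f gs = 0"
  obtains c \<psi> where "pcoch 2 \<psi>" "\<And>gs. f gs = c * area gs + dlt \<psi> gs"
proof -
  obtain F P Q where F: "cell 0 0 1 2 F" and P: "cell 1 0 (-1) 1 P" and Q: "cell 0 1 (-1) 1 Q"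
    and F_f: "\<And>z gs. dlt (F z) gs = f gs"
    and P_F: "\<And>z gs. dlt (P z) gs = dif1 F z gs" and Q_F: "\<And>z gs. dlt (Q z) gs = dif2 F z gs"
    and R: "cell 1 1 1 1 (\<lambda>z gs. dif1 Q z gs - dif2 P z gs)"
    and R0: "\<And>z gs. dlt (\<lambda>gs. dif1 Q z gs - dif2 P z gs) gs = 0"
    using point_squares [OF assms(1) _ assms(2)] by auto
  define r where "r = (\<lambda>z gs. dif1 Q z gs - dif2 P z gs)"
  define c where "c = r (0, 0) [one_mon] / (-2)"
  have rc: "r z [g] = -2 * c" for z g
  proof -
    obtain z1 z2 where z: "z = (z1, z2)" by (cases z)
    have "r (z1 + 0, z2 + 0) (map (gmul (z1, z2, False)) [one_mon]) = r (0, 0) [one_mon]"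
      unfolding r_def by (rule cell_translate [OF R])
    moreover have "r z [g] = r z [gmul (z1, z2, False) one_mon]"
      unfolding r_def by (rule dlt_singleton_const [OF R0])
    ultimately show ?thesis by (simp add: c_def z)
  qed
  note A = area_zigzag
  have *: "dif1 (\<lambda>z gs. Q z gs - c * area_Q z gs) z gs = dif2 (\<lambda>z gs. P z gs - c * area_P z gs) z gs" for z gs
  proof (cases "length gs = 1")
    case True
    then obtain g where "gs = [g]" by (auto simp: length_Suc_conv)
    then have "r z gs = -2 * c" by (simp add: rc)
    moreover have "c * (dif1 area_Q z gs - dif2 area_P z gs) = c * - 2" using A(7) [OF True] by simp
    ultimately show ?thesis unfolding r_def dif1_def dif2_def by algebra
  next
    case False
    then show ?thesis
      using ecoch_length [OF P] ecoch_length [OF Q] ecoch_length [OF A(2)] ecoch_length [OF A(3)]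
      by (simp add: dif1_def dif2_def)
  qed
  have "cell 0 0 1 (Suc 1) (\<lambda>z gs. F z gs - c * area_F z gs)"
    unfolding Suc_1 by (intro ecoch_diff ecoch_cmult F A)
  moreover have "cell 1 0 (-1) 1 (\<lambda>z gs. P z gs - c * area_P z gs)"
    "cell 0 1 (-1) 1 (\<lambda>z gs. Q z gs - c * area_Q z gs)"
    by (intro ecoch_diff ecoch_cmult P Q A)+
  ultimately obtain \<psi> where "pcoch (Suc 1) \<psi>" "\<And>gs. dlt \<psi> gs = f gs - c * area gs"
  proof (rule point_zigzag [OF _ _ _ order_refl])
    fix z gs
    show "dlt (\<lambda>gs. F z gs - c * area_F z gs) gs = f gs - c * area gs"
      by (simp add: dlt_diff dlt_cmult F_f A)
    show "dlt (\<lambda>gs. P z gs - c * area_P z gs) gs = dif1 (\<lambda>z gs. F z gs - c * area_F z gs) z gs"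
      by (simp add: dlt_diff dlt_cmult P_F A) (simp add: dif1_def algebra_simps)
    show "dlt (\<lambda>gs. Q z gs - c * area_Q z gs) gs = dif2 (\<lambda>z gs. F z gs - c * area_F z gs) z gs"
      by (simp add: dlt_diff dlt_cmult Q_F A) (simp add: dif2_def algebra_simps)
  qed (use * in auto)
  then show thesis using that [of \<psi> c] by (simp add: numeral_2_eq_2)
qed

text \<open>Evaluation on the fundamental cycle of the torus: the unit square is cut along a
  diagonal into two oppositely oriented triangles, and translations identify opposite sides. Both
  triangles give \<open>\<psi>\<close> the same boundary value, but \<open>area\<close> opposite
  ones.\<close>

lemma area_not_coboundary:
  assumes "pcoch 2 \<psi>" "\<And>gs. dlt \<psi> gs = c * area gs"
  shows "c = 0"
proof -
  define o' a b ab where "o' = ((0, 0, False) :: mon)" and "a = ((1, 0, False) :: mon)"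
    and "b = ((0, 1, False) :: mon)" and "ab = ((1, 1, False) :: mon)"
  note defs = o'_def a_def b_def ab_def
  have inv: "\<psi> (map (gmul h) gs) = \<psi> gs" for h gs using assms(1) unfolding pcoch_def by blast
  have "\<psi> [a, ab] = \<psi> [o', b]" using inv [of a "[o', b]"] by (simp add: defs sg_def)
  moreover have "\<psi> [b, ab] = \<psi> [o', a]" using inv [of b "[o', a]"] by (simp add: defs sg_def)
  moreover have "\<psi> [a, ab] - (\<psi> [o', ab] - \<psi> [o', a]) = c * 1"
    using assms(2) [of "[o', a, ab]"] assms(1) by (simp add: area_3 defs pcoch_def)
  moreover have "\<psi> [b, ab] - (\<psi> [o', ab] - \<psi> [o', b]) = c * -1"
    using assms(2) [of "[o', b, ab]"] assms(1) by (simp add: area_3 defs pcoch_def)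
  ultimately have "c = - c" by (simp add: algebra_simps)
  then show ?thesis by simp
qed

section \<open>Hochschild cochains as equivariant cochains\<close>

lemma gmul_assoc: "gmul (gmul x y) z = gmul x (gmul y z)"
  by (cases x; cases y; cases z) (auto simp: sg_def algebra_simps)

lemma gmul_ginv [simp]: "gmul (ginv x) x = one_mon" "gmul x (ginv x) = one_mon"
  by (cases x; simp add: sg_def one_mon_def)+

lemma gmul_ginv_cancel [simp]: "gmul (ginv x) (gmul x y) = y" "gmul x (gmul (ginv x) y) = y"
  by (simp_all flip: gmul_assoc)

lemma ginv_gmul: "ginv (gmul x y) = gmul (ginv y) (ginv x)"
  by (cases x; cases y) (auto simp: sg_def)

text \<open>In the algebra, \<open>u g\<inverse> u h = \<lambda>^quot_exp g h u (g\<inverse> h)\<close> and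
  \<open>u g\<inverse> u x u h = \<lambda>^sandwich_exp g x h u (g\<inverse> x h)\<close>.\<close>

definition quot_exp :: "mon \<Rightarrow> mon \<Rightarrow> int" where
  "quot_exp g h = mexp (ginv g) h - mexp (ginv g) g"

definition sandwich_exp :: "mon \<Rightarrow> mon \<Rightarrow> mon \<Rightarrow> int" where
  "sandwich_exp g x h = mexp (ginv g) x + mexp (gmul (ginv g) x) h - mexp (ginv g) g"

definition act :: "mon \<Rightarrow> mon \<Rightarrow> mon" where
  "act h x = gmul (gmul h x) (ginv h)"

text \<open>In the algebra,
  \<open>u h u x = \<lambda>^(conj_exp h x) u (act h x) u h\<close>.\<close>

definition conj_exp :: "mon \<Rightarrow> mon \<Rightarrow> int" where
  "conj_exp h x = mexp h x - mexp (act h x) h"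

definition chi :: "real \<Rightarrow> mon \<Rightarrow> mon \<Rightarrow> complex" where
  "chi \<theta> h x = lam \<theta> (- conj_exp h x)"

text \<open>This and the next two identities are the phases of associativity when neighbouring
  arguments are multiplied and \<open>h\<close> drops out: in an inner face, the first face and the
  last face.\<close>

lemma quot_exp_quot_exp: "quot_exp g h + quot_exp h k + mexp (gmul (ginv g) h) (gmul (ginv h) k) = quot_exp g k"
  by (cases g; cases h; cases k) (auto simp: quot_exp_def sg_def algebra_simps)

lemma sandwich_exp_quot_exp: "sandwich_exp g x h + quot_exp h k + mexp (gmul (gmul (ginv g) x) h) (gmul (ginv h) k) = sandwich_exp g x k"
  by (cases g; cases h; cases k; cases x) (auto simp: quot_exp_def sandwich_exp_def sg_def algebra_simps)

lemma quot_exp_sandwich_exp: "quot_exp g h + sandwich_exp h x k + mexp (gmul (ginv g) h) (gmul (gmul (ginv h) x) k) = sandwich_exp g x k"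
  by (cases g; cases h; cases k; cases x) (auto simp: quot_exp_def sandwich_exp_def sg_def algebra_simps)

text \<open>The correction is a difference of end point terms. It telescopes along a tuple and
  cancels against that of \<open>sandwich_exp\<close>, so only \<open>conj_exp\<close>
  survives.\<close>

lemma quot_exp_translate: "quot_exp (gmul h g) (gmul h k) = quot_exp g k + mexp h g - mexp h k"
  by (cases g; cases h; cases k) (auto simp: quot_exp_def sg_def algebra_simps)

lemma sandwich_exp_translate: "sandwich_exp (gmul h g) (act h x) (gmul h k) = sandwich_exp g x k + mexp h g - mexp h k - conj_exp h x"
  by (cases g; cases h; cases k; cases x) (auto simp: sandwich_exp_def conj_exp_def act_def sg_def algebra_simps)

section \<open>From tuples of arguments to tuples of group elements\<close>

fun gdiffs :: "mon list \<Rightarrow> mon list" where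
  "gdiffs (g # h # gs) = gmul (ginv g) h # gdiffs (h # gs)"
| "gdiffs _ = []"

fun dexp :: "mon list \<Rightarrow> int" where
  "dexp (g # h # gs) = quot_exp g h + dexp (h # gs)"
| "dexp _ = 0"

lemma length_gdiffs [simp]: "length (gdiffs gs) = length gs - 1"
  by (induction gs rule: gdiffs.induct) auto

lemma gdiffs_append: "gdiffs (p @ g # s) = gdiffs (p @ [g]) @ gdiffs (g # s)"
  by (induction p rule: gdiffs.induct) auto

lemma dexp_append: "dexp (p @ g # s) = dexp (p @ [g]) + dexp (g # s)"
  by (induction p rule: gdiffs.induct) auto

lemma gdiffs_map [simp]: "gdiffs (map (gmul h) gs) = gdiffs gs"
  by (induction gs rule: gdiffs.induct) (auto simp: ginv_gmul gmul_assoc)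

lemma dexp_map: "gs \<noteq> [] \<Longrightarrow> dexp (map (gmul h) gs) = dexp gs + mexp h (hd gs) - mexp h (last gs)"
  by (induction gs rule: gdiffs.induct) (auto simp: quot_exp_translate)

definition loop :: "mon list \<Rightarrow> mon \<Rightarrow> mon list" where
  "loop gs x = gmul (gmul (ginv (last gs)) x) (hd gs) # gdiffs gs"

definition lexp :: "mon list \<Rightarrow> mon \<Rightarrow> int" where
  "lexp gs x = sandwich_exp (last gs) x (hd gs) + dexp gs"

text \<open>A tuple \<open>(g\<^sub>0, \<dots>, g\<^sub>n)\<close> and \<open>x\<close> give the arguments
  \<open>a\<^sub>0 = u g\<^sub>n\<inverse> u x u g\<^sub>0\<close> and \<open>a\<^sub>i = u g\<^sub>i\<^sub>-\<^sub>1\<inverse> u g\<^sub>i\<close>, for which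
  the faces of the Hochschild complex are the omissions of the \<open>g\<^sub>i\<close>.\<close>

definition unroll :: "real \<Rightarrow> cochain \<Rightarrow> mon \<Rightarrow> mon list \<Rightarrow> complex" where
  "unroll \<theta> \<phi> x gs = (if gs = [] then 0 else lam \<theta> (lexp gs x) * \<phi> (loop gs x))"

lemma length_loop [simp]: "gs \<noteq> [] \<Longrightarrow> length (loop gs x) = length gs"
  by (simp add: loop_def)

lemma loop_map: "gs \<noteq> [] \<Longrightarrow> loop (map (gmul h) gs) (act h x) = loop gs x"
  by (simp add: loop_def last_map hd_map ginv_gmul act_def gmul_assoc)

lemma lexp_map: "gs \<noteq> [] \<Longrightarrow> lexp (map (gmul h) gs) (act h x) = lexp gs x - conj_exp h x"
  by (simp add: lexp_def last_map hd_map sandwich_exp_translate dexp_map)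

lemma ecoch_unroll:
  assumes "\<And>xs. length xs \<noteq> N \<Longrightarrow> \<phi> xs = 0"
  shows "ecoch act (chi \<theta>) N (unroll \<theta> \<phi>)"
  unfolding ecoch_def
proof (intro conjI allI impI)
  fix h x gs
  show "unroll \<theta> \<phi> (act h x) (map (gmul h) gs) = chi \<theta> h x * unroll \<theta> \<phi> x gs"
    using lam_add [of \<theta> "lexp gs x" "- conj_exp h x"]
    by (simp add: unroll_def loop_map lexp_map chi_def)
qed (simp add: unroll_def assms)

lemma unroll_face:
  assumes "i + 1 < length gs"
  shows "lam \<theta> (lexp gs x) * (lam \<theta> (mexp (loop gs x ! i) (loop gs x ! (i + 1))) *
      \<phi> (take i (loop gs x) @ gmul (loop gs x ! i) (loop gs x ! (i + 1)) # drop (i + 2) (loop gs x)))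
    = unroll \<theta> \<phi> x (take i gs @ drop (Suc i) gs)"
proof (cases i)
  case 0
  obtain g h r where gs: "gs = g # h # r"
    using assms by (cases gs; cases "tl gs") auto
  have "lexp gs x + mexp (gmul (gmul (ginv (last gs)) x) g) (gmul (ginv g) h) = lexp (h # r) x"
    using sandwich_exp_quot_exp [of "last gs" x g h] by (simp add: gs lexp_def)
  then have e: "lam \<theta> (lexp gs x) * lam \<theta> (mexp (gmul (gmul (ginv (last gs)) x) g) (gmul (ginv g) h)) = lam \<theta> (lexp (h # r) x)"
    by (simp flip: lam_add)
  show ?thesis
    using e unfolding 0 by (simp add: gs loop_def unroll_def gmul_assoc)
next
  case (Suc j)
  define p g h k s where "p = take j gs" and "g = gs ! j" and "h = gs ! (j + 1)" and "k = gs ! (j + 2)"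
    and "s = drop (j + 3) gs"
  have gs: "gs = p @ g # h # k # s" and j: "j = length p"
    using assms Suc unfolding p_def g_def h_def k_def s_def
    by (simp_all add: Cons_nth_drop_Suc numeral_3_eq_3)
  define A where "A = gmul (gmul (ginv (last gs)) x) (hd gs)"
  have L: "loop gs x = A # gdiffs (p @ [g]) @ gmul (ginv g) h # gmul (ginv h) k # gdiffs (k # s)"
    unfolding loop_def A_def [symmetric] by (simp add: gs gdiffs_append [of p g "h # k # s"])
  have rem: "take i gs @ drop (Suc i) gs = p @ g # k # s" unfolding Suc j gs by simp
  have ends: "last (p @ g # k # s) = last gs" "hd (p @ g # k # s) = hd gs"
    by (auto simp: gs hd_append)
  have L': "loop (p @ g # k # s) x = A # gdiffs (p @ [g]) @ gmul (ginv g) k # gdiffs (k # s)"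
    unfolding loop_def ends A_def [symmetric] by (simp add: gdiffs_append [of p g "k # s"])
  have "lexp gs x + mexp (gmul (ginv g) h) (gmul (ginv h) k) = lexp (p @ g # k # s) x"
    unfolding lexp_def ends using quot_exp_quot_exp [of g h k] by (simp add: gs dexp_append [of p g "h # k # s"] dexp_append [of p g "k # s"])
  then have e: "lam \<theta> (lexp gs x) * lam \<theta> (mexp (gmul (ginv g) h) (gmul (ginv h) k)) = lam \<theta> (lexp (p @ g # k # s) x)"
    by (simp flip: lam_add)
  have l: "length (gdiffs (p @ [g])) = j" by (simp add: j)
  show ?thesis
    unfolding rem unroll_def L' using e l
    by (simp add: L Suc nth_append gmul_assoc)
qed

lemma unroll_last_face:
  assumes "2 \<le> length gs"
  shows "lam \<theta> (lexp gs x) * (lam \<theta> (mexp (last (loop gs x)) (hd (loop gs x))) *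
      \<phi> (gmul (last (loop gs x)) (hd (loop gs x)) # butlast (tl (loop gs x))))
    = unroll \<theta> \<phi> x (butlast gs)"
proof -
  obtain q h where q: "gs = q @ [h]" using assms by (cases gs rule: rev_cases) auto
  then obtain p g where "q = p @ [g]" using assms by (cases q rule: rev_cases) auto
  then have gs: "gs = p @ [g, h]" using q by simp
  have hd: "hd (p @ [g]) = hd gs" by (simp add: gs hd_append)
  have L: "loop gs x = gmul (gmul (ginv h) x) (hd gs) # gdiffs (p @ [g]) @ [gmul (ginv g) h]"
    by (simp add: loop_def gs gdiffs_append [of p g "[h]"])
  have "lexp gs x + mexp (gmul (ginv g) h) (gmul (gmul (ginv h) x) (hd gs)) = lexp (p @ [g]) x"
    unfolding lexp_def hd using quot_exp_sandwich_exp [of g h x "hd gs"] by (simp add: gs dexp_append [of p g "[h]"])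
  then have e: "lam \<theta> (lexp gs x) * lam \<theta> (mexp (gmul (ginv g) h) (gmul (gmul (ginv h) x) (hd gs))) = lam \<theta> (lexp (p @ [g]) x)"
    by (simp flip: lam_add)
  have "butlast gs = p @ [g]" by (simp add: gs butlast_append)
  moreover have "loop (p @ [g]) x = gmul (gmul (ginv g) x) (hd gs) # gdiffs (p @ [g])"
    unfolding loop_def hd by simp
  ultimately show ?thesis
    unfolding unroll_def using e by (simp add: L gmul_assoc)
qed

lemma unroll_hoch_b: "unroll \<theta> (hoch_b \<theta> \<phi>) x gs = dlt (unroll \<theta> \<phi> x) gs"
proof (cases "2 \<le> length gs")
  case False
  then consider "gs = []" | g where "gs = [g]"
    by (cases gs; cases "tl gs") auto
  then show ?thesis by cases (simp_all add: unroll_def hoch_b_short)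
next
  case True
  then have ne: "gs \<noteq> []" and len: "length gs = Suc (length gs - 1)" by auto
  have "unroll \<theta> (hoch_b \<theta> \<phi>) x gs = lam \<theta> (lexp gs x) * bprime \<theta> \<phi> (loop gs x) +
      (-1) ^ (length gs - 1) * (lam \<theta> (lexp gs x) * (lam \<theta> (mexp (last (loop gs x)) (hd (loop gs x))) *
        \<phi> (gmul (last (loop gs x)) (hd (loop gs x)) # butlast (tl (loop gs x)))))"
    using True ne by (simp add: unroll_def hoch_b_bprime algebra_simps)
  also have "lam \<theta> (lexp gs x) * bprime \<theta> \<phi> (loop gs x)
      = (\<Sum>i<length gs - 1. (-1) ^ i * unroll \<theta> \<phi> x (take i gs @ drop (Suc i) gs))"
    unfolding bprime_def sum_distrib_left length_loop [OF ne]
  proof (rule sum.cong)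
    fix i assume "i \<in> {..<length gs - 1}"
    then have "i + 1 < length gs" by auto
    from unroll_face [OF this, of \<theta> x \<phi>, symmetric]
    show "lam \<theta> (lexp gs x) * ((-1) ^ i * (lam \<theta> (mexp (loop gs x ! i) (loop gs x ! (i + 1))) *
      \<phi> (take i (loop gs x) @ gmul (loop gs x ! i) (loop gs x ! (i + 1)) # drop (i + 2) (loop gs x))))
      = (-1) ^ i * unroll \<theta> \<phi> x (take i gs @ drop (Suc i) gs)" by simp
  qed simp
  also have "lam \<theta> (lexp gs x) * (lam \<theta> (mexp (last (loop gs x)) (hd (loop gs x))) *
        \<phi> (gmul (last (loop gs x)) (hd (loop gs x)) # butlast (tl (loop gs x))))
      = unroll \<theta> \<phi> x (take (length gs - 1) gs @ drop (Suc (length gs - 1)) gs)"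
    unfolding unroll_last_face [OF True] by (simp add: butlast_conv_take)
  also have "(\<Sum>i<length gs - 1. (-1) ^ i * unroll \<theta> \<phi> x (take i gs @ drop (Suc i) gs)) +
      (-1) ^ (length gs - 1) * unroll \<theta> \<phi> x (take (length gs - 1) gs @ drop (Suc (length gs - 1)) gs)
      = dlt (unroll \<theta> \<phi> x) gs"
    unfolding dlt_eq_sum by (metis (no_types, lifting) len sum.lessThan_Suc)
  finally show ?thesis .
qed

section \<open>The inverse passage\<close>

fun path :: "mon \<Rightarrow> mon list \<Rightarrow> mon list" where
  "path g [] = [g]"
| "path g (a # as) = g # path (gmul g a) as"

lemma path_not_Nil [simp]: "path g as \<noteq> []"
  by (cases as) auto

lemma hd_path [simp]: "hd (path g as) = g"
  by (cases as) auto

lemma length_path [simp]: "length (path g as) = Suc (length as)"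
  by (induction as arbitrary: g) auto

lemma gdiffs_path [simp]: "gdiffs (path g as) = as"
proof (induction as arbitrary: g)
  case (Cons a as)
  obtain r where r: "path (gmul g a) as = gmul g a # r" by (cases as) auto
  then show ?case using Cons [of "gmul g a"] by simp
qed simp

lemma path_gdiffs: "gs \<noteq> [] \<Longrightarrow> path (hd gs) (gdiffs gs) = gs"
  by (induction gs rule: gdiffs.induct) auto

lemma map_path: "map (gmul h) (path g as) = path (gmul h g) as"
  by (induction as arbitrary: g) (auto simp: gmul_assoc)

text \<open>Equivariance permits \<open>g0 = 1\<close>. Then the later arguments are the increments
  of a path, and \<open>a0 = gn^-1 x\<close> determines \<open>x = gn a0\<close>.\<close>

definition roll :: "real \<Rightarrow> (mon \<Rightarrow> mon list \<Rightarrow> complex) \<Rightarrow> cochain" where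
  "roll \<theta> f xs = (if xs = [] then 0 else
     let gs = path one_mon (tl xs); x = gmul (last gs) (hd xs) in lam \<theta> (- lexp gs x) * f x gs)"

lemma lam_minus_cancel [simp]: "lam \<theta> (- k) * (lam \<theta> k * z) = z" "lam \<theta> k * (lam \<theta> (- k) * z) = z"
proof -
  have "lam \<theta> k * lam \<theta> (- k) = 1" by (simp flip: lam_add)
  then show "lam \<theta> (- k) * (lam \<theta> k * z) = z" "lam \<theta> k * (lam \<theta> (- k) * z) = z"
    by (simp_all add: mult.assoc [symmetric]) (simp add: mult.commute)
qed

lemma roll_unroll: "xs \<noteq> [] \<Longrightarrow> roll \<theta> (unroll \<theta> \<phi>) xs = \<phi> xs"
  by (simp add: roll_def unroll_def loop_def Let_def)

lemma unroll_roll: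
  assumes f: "ecoch act (chi \<theta>) N f" and "gs \<noteq> []"
  shows "unroll \<theta> (roll \<theta> f) x gs = f x gs"
proof -
  \<comment> \<open>Every tuple is a translate of one starting at the unit; the equivariance of
    \<open>f\<close> compensates the change of phase.\<close>
  define g gs' x' where "g = hd gs" and "gs' = path one_mon (gdiffs gs)" and "x' = act (ginv g) x"
  have gs: "gs = map (gmul g) gs'"
    using path_gdiffs [OF \<open>gs \<noteq> []\<close>] by (simp add: gs'_def map_path g_def)
  have inv: "ginv (ginv g) = g" by (cases g) (simp add: sg_def)
  have x: "x = act g x'" by (simp add: x'_def act_def gmul_assoc inv)
  have ne: "gs' \<noteq> []" by (simp add: gs'_def)
  have "last gs = gmul g (last gs')" unfolding gs using ne by (simp add: last_map)
  then have x'': "gmul (last gs') (gmul (gmul (ginv (last gs)) x) g) = x'"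
    by (simp add: ginv_gmul gmul_assoc x'_def act_def inv)
  have "unroll \<theta> (roll \<theta> f) x gs = lam \<theta> (lexp gs x) * (lam \<theta> (- lexp gs' x') * f x' gs')"
    using \<open>gs \<noteq> []\<close>
    by (simp add: unroll_def roll_def loop_def Let_def gs'_def [symmetric] g_def [symmetric] x'')
  also have "lexp gs x = lexp gs' x' + (- conj_exp g x')"
    unfolding x by (simp add: gs lexp_map ne)
  also have "lam \<theta> (lexp gs' x' + (- conj_exp g x')) * (lam \<theta> (- lexp gs' x') * f x' gs') = chi \<theta> g x' * f x' gs'"
    unfolding lam_add chi_def by (simp add: mult.left_commute)
  also have "\<dots> = f x gs"
    using ecoch_act [OF f, of g x' gs'] by (simp add: x gs)
  finally show ?thesis .
qed

section \<open>Hochschild cohomology\<close>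

lemma act_False: "act (n, m, e) (v1, v2, False) = (sg e * v1, sg e * v2, False)"
  by (auto simp: act_def sg_def)

lemma act_True: "act (n, m, e) (v1, v2, True) = (2 * n + sg e * v1, 2 * m + sg e * v2, True)"
  by (auto simp: act_def sg_def)

lemma act_one [simp]: "act h one_mon = one_mon"
  by (simp add: act_def)

lemma act_eq_one: "act h x = one_mon \<longleftrightarrow> x = one_mon"
  by (cases h; cases x; cases "snd (snd x)") (auto simp: act_False act_True one_mon_def sg_def)

lemma conj_exp_False: "conj_exp (n, m, e) (v1, v2, False) = sg e * (m * v1 - n * v2)"
  by (simp add: conj_exp_def act_False sg_def algebra_simps)

lemma conj_exp_True: "conj_exp (n, m, e) (v1, v2, True) = sg e * m * v1 + (2 * m + sg e * v2) * n"
  by (auto simp: conj_exp_def act_True sg_def algebra_simps)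

lemma chi_one [simp]: "chi \<theta> h one_mon = 1"
  by (simp add: chi_def conj_exp_def)

text \<open>Every use of the irrationality of \<open>\<theta>\<close> goes through this
  fact.\<close>

lemma lam_eq_1:
  assumes "\<theta> \<notin> \<rat>" "lam \<theta> k = 1"
  shows "k = 0"
proof (rule ccontr)
  assume "k \<noteq> 0"
  have "lam \<theta> k = cis (2 * pi * (\<theta> * k))"
    by (simp add: lam_def cis_conv_exp algebra_simps)
  then have "cos (2 * pi * (\<theta> * k)) = 1" using assms(2) by (metis cis.sel(1) one_complex.sel(1))
  then obtain n :: int where "2 * pi * (\<theta> * k) = of_int n * 2 * pi" using cos_one_2pi_int by blast
  then have "\<theta> * k = n" by simp
  then have "\<theta> = of_int n / of_int k" using \<open>k \<noteq> 0\<close> by (simp add: field_simps)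
  then have "\<theta> \<in> \<rat>" by simp
  then show False using assms(1) by simp
qed

section \<open>The classes of translations and reflections\<close>

definition trans_mons :: "mon set" where
  "trans_mons = {(v1, v2, False) | v1 v2. v1 \<noteq> 0 \<or> v2 \<noteq> 0}"

definition refl_mons :: "mon set" where
  "refl_mons = {(v1, v2, True) | v1 v2. True}"

lemma mon_cases:
  obtains "x = one_mon" | "x \<in> trans_mons" "x \<notin> refl_mons" "x \<noteq> one_mon"
    | "x \<in> refl_mons" "x \<notin> trans_mons" "x \<noteq> one_mon"
  by (cases x; cases "snd (snd x)") (auto simp: trans_mons_def refl_mons_def one_mon_def)

lemma act_trans_mons: "act h x \<in> trans_mons \<longleftrightarrow> x \<in> trans_mons"
  by (cases h; cases x; cases "snd (snd x)") (auto simp: trans_mons_def act_False act_True sg_def)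

lemma act_refl_mons: "act h x \<in> refl_mons \<longleftrightarrow> x \<in> refl_mons"
  by (cases h; cases x; cases "snd (snd x)") (auto simp: refl_mons_def act_False act_True)

text \<open>All translations commute with a translation \<open>x\<close> in the group. The quarter
  turn is chosen because the commutator exponent \<open>m * v1 - n * v2\<close> becomes
  \<open>v1^2 + v2^2\<close>, nonzero for every nonzero \<open>x\<close>, and because it is
  compatible with the action.\<close>

fun rot90 :: "mon \<Rightarrow> mon" where
  "rot90 (v1, v2, e) = (- v2, v1, False)"

lemma chi_rot90: "x \<in> trans_mons \<Longrightarrow> chi \<theta> (rot90 x) x = lam \<theta> (- ((fst x)\<^sup>2 + (fst (snd x))\<^sup>2))"
  by (auto simp: trans_mons_def chi_def conj_exp_False sg_def power2_eq_square)

lemma chi_rot90_neq_1: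
  assumes "\<theta> \<notin> \<rat>" "x \<in> trans_mons"
  shows "chi \<theta> (rot90 x) x \<noteq> 1"
proof
  assume "chi \<theta> (rot90 x) x = 1"
  then have "- ((fst x)\<^sup>2 + (fst (snd x))\<^sup>2) = 0"
    using lam_eq_1 [OF assms(1)] unfolding chi_rot90 [OF assms(2)] by blast
  then have "fst x = 0 \<and> fst (snd x) = 0" using sum_power2_eq_zero_iff [of "fst x" "fst (snd x)"] by linarith
  then show False using assms(2) by (auto simp: trans_mons_def)
qed

lemma act_rot90: "x \<in> trans_mons \<Longrightarrow> act (rot90 x) x = x"
  by (auto simp: trans_mons_def act_False sg_def)

lemma trans_acyclic:
  assumes "\<theta> \<notin> \<rat>" and f: "ecoch act (chi \<theta>) N f" "1 \<le> N" "\<And>x gs. dlt (f x) gs = 0"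
  obtains \<psi> where "ecoch act (chi \<theta>) (N - 1) \<psi>" "\<And>x gs. x \<in> trans_mons \<Longrightarrow> dlt (\<psi> x) gs = f x gs"
    "\<And>x gs. x \<notin> trans_mons \<Longrightarrow> \<psi> x gs = 0"
proof (rule nontrivial_character_acyclic [OF f(1,2) act_trans_mons, where w = rot90])
  fix h x g assume x: "x \<in> trans_mons"
  show "gmul (rot90 (act h x)) (gmul h g) = gmul h (gmul (rot90 x) g)"
    using x by (cases h; cases g) (auto simp: trans_mons_def act_False sg_def)
  show "chi \<theta> (rot90 (act h x)) (act h x) = chi \<theta> (rot90 x) x"
    using x act_trans_mons [of h x] unfolding chi_rot90 [OF x]
    by (subst chi_rot90, simp) (cases h; auto simp: trans_mons_def act_False sg_def)
qed (use assms that chi_rot90_neq_1 act_rot90 in auto)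

lemma refl_acyclic:
  assumes f: "ecoch act (chi \<theta>) N f" "2 \<le> N" "\<And>x gs. dlt (f x) gs = 0"
  obtains \<psi> where "ecoch act (chi \<theta>) (N - 1) \<psi>" "\<And>x gs. x \<in> refl_mons \<Longrightarrow> dlt (\<psi> x) gs = f x gs"
    "\<And>x gs. x \<notin> refl_mons \<Longrightarrow> \<psi> x gs = 0"
proof -
  \<comment> \<open>\<open>\<gamma>\<close> and \<open>\<gamma>'\<close> are the two elements, a
    translation and a reflection, that conjugate the representative
    \<open>(v1 mod 2, v2 mod 2, True)\<close> to \<open>x\<close>.\<close>
  define \<gamma> :: "mon \<Rightarrow> mon" where "\<gamma> = (\<lambda>(v1, v2, e). (v1 div 2, v2 div 2, False))"
  define \<gamma>' :: "mon \<Rightarrow> mon" where "\<gamma>' = (\<lambda>(v1, v2, e). (v1 div 2 + v1 mod 2, v2 div 2 + v2 mod 2, True))"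
  have "(\<gamma> (act h x) = gmul h (\<gamma> x) \<and> \<gamma>' (act h x) = gmul h (\<gamma>' x)) \<or>
        (\<gamma> (act h x) = gmul h (\<gamma>' x) \<and> \<gamma>' (act h x) = gmul h (\<gamma> x))" if x: "x \<in> refl_mons" for h x
  proof -
    obtain n m e v1 v2 where "h = (n, m, e)" "x = (v1, v2, True)"
      using x by (cases h) (auto simp: refl_mons_def)
    moreover have "(2 * i - v) div 2 = i - (v div 2 + v mod 2)" "(2 * i - v) mod 2 = v mod 2" for i v :: int
      by presburger+
    ultimately show ?thesis
      by (cases e) (simp_all add: \<gamma>_def \<gamma>'_def act_True sg_def)
  qed
  then show thesis
    using finite_stabiliser_acyclic [OF f(1,2) act_refl_mons, of \<gamma> \<gamma>'] f(3) that by metis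
qed

lemma reduce_to_unit:
  assumes "\<theta> \<notin> \<rat>" and f: "ecoch act (chi \<theta>) N f" "2 \<le> N" "\<And>x gs. dlt (f x) gs = 0"
  obtains \<psi> where "ecoch act (chi \<theta>) (N - 1) \<psi>" "\<And>x gs. x \<noteq> one_mon \<Longrightarrow> dlt (\<psi> x) gs = f x gs"
    "\<And>gs. \<psi> one_mon gs = 0"
proof -
  have "1 \<le> N" using f(2) by simp
  then obtain \<psi>1 where 1: "ecoch act (chi \<theta>) (N - 1) \<psi>1" "\<And>x gs. x \<in> trans_mons \<Longrightarrow> dlt (\<psi>1 x) gs = f x gs"
    "\<And>x gs. x \<notin> trans_mons \<Longrightarrow> \<psi>1 x gs = 0"
    using trans_acyclic [OF assms(1) f(1) _ f(3)] by metis
  obtain \<psi>2 where 2: "ecoch act (chi \<theta>) (N - 1) \<psi>2" "\<And>x gs. x \<in> refl_mons \<Longrightarrow> dlt (\<psi>2 x) gs = f x gs"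
    "\<And>x gs. x \<notin> refl_mons \<Longrightarrow> \<psi>2 x gs = 0"
    using refl_acyclic [OF f] by metis
  show thesis
  proof (rule that)
    show "ecoch act (chi \<theta>) (N - 1) (\<lambda>x gs. \<psi>1 x gs + \<psi>2 x gs)"
      by (intro ecoch_add 1 2)
    show "dlt (\<lambda>gs. \<psi>1 x gs + \<psi>2 x gs) gs = f x gs" if "x \<noteq> one_mon" for x gs
      using that by (cases x rule: mon_cases) (simp_all add: 1(2,3) 2(2,3) cong: dlt_cong)
    show "\<psi>1 one_mon gs + \<psi>2 one_mon gs = 0" for gs
      by (simp add: 1(3) 2(3) one_mon_def trans_mons_def refl_mons_def)
  qed
qed

section \<open>The unit class and the assembled Hochschild cohomology\<close>

lemma pcoch_at_one: "ecoch act (chi \<theta>) N f \<Longrightarrow> pcoch N (f one_mon)"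
  using ecoch_act [of act "chi \<theta>" N f _ one_mon] by (simp add: pcoch_def ecoch_length)

definition at_one :: "(mon list \<Rightarrow> complex) \<Rightarrow> mon \<Rightarrow> mon list \<Rightarrow> complex" where
  "at_one F x gs = (if x = one_mon then F gs else 0)"

lemma ecoch_at_one: "pcoch N F \<Longrightarrow> ecoch act (chi \<theta>) N (at_one F)"
  by (simp add: ecoch_def pcoch_def at_one_def act_eq_one del: gmul.simps) 

lemma dlt_at_one: "dlt (at_one F x) gs = at_one (dlt F) x gs"
  by (simp add: at_one_def [abs_def])

definition conc :: "nat \<Rightarrow> cochain \<Rightarrow> bool" where
  "conc N \<phi> \<longleftrightarrow> (\<forall>xs. length xs \<noteq> N \<longrightarrow> \<phi> xs = 0)"

lemma concD: "conc N \<phi> \<Longrightarrow> length xs \<noteq> N \<Longrightarrow> \<phi> xs = 0"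
  by (simp add: conc_def)

lemma conc_roll:
  assumes "ecoch a \<chi> N f" "1 \<le> N"
  shows "conc N (roll \<theta> f)"
  unfolding conc_def
proof (intro allI impI)
  fix xs :: "mon list" assume "length xs \<noteq> N"
  then show "roll \<theta> f xs = 0"
    by (cases xs) (simp_all add: roll_def Let_def ecoch_length [OF assms(1)])
qed

lemma roll_cong:
  assumes "\<And>x gs. gs \<noteq> [] \<Longrightarrow> f x gs = h x gs"
  shows "roll \<theta> f xs = roll \<theta> h xs"
  by (simp add: roll_def Let_def assms)

lemma unroll_inject:
  assumes "\<And>x gs. gs \<noteq> [] \<Longrightarrow> unroll \<theta> \<phi> x gs = unroll \<theta> \<psi> x gs" "xs \<noteq> []"
  shows "\<phi> xs = \<psi> xs"
proof -
  have "roll \<theta> (unroll \<theta> \<phi>) xs = roll \<theta> (unroll \<theta> \<psi>) xs" by (rule roll_cong) (rule assms(1))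
  then show ?thesis unfolding roll_unroll [OF assms(2)] .
qed

lemma unroll_zero [simp]: "unroll \<theta> (\<lambda>_. 0) x gs = 0"
  by (simp add: unroll_def)

lemma hoch_b_hoch_b: "hoch_b \<theta> (hoch_b \<theta> \<phi>) xs = 0"
proof (cases "xs = []")
  case False
  have "unroll \<theta> (hoch_b \<theta> (hoch_b \<theta> \<phi>)) x gs = unroll \<theta> (\<lambda>_. 0) x gs" for x gs
    by (simp add: unroll_hoch_b [abs_def])
  then show ?thesis by (rule unroll_inject [OF _ False])
qed (simp add: hoch_b_short)

lemma unroll_add: "unroll \<theta> (\<lambda>xs. \<phi> xs + \<psi> xs) x gs = unroll \<theta> \<phi> x gs + unroll \<theta> \<psi> x gs"
  by (simp add: unroll_def algebra_simps)

lemma unroll_cmult: "unroll \<theta> (\<lambda>xs. c * \<phi> xs) x gs = c * unroll \<theta> \<phi> x gs"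
  by (simp add: unroll_def)

lemma hochschild_cocycle_reduce:
  assumes "\<theta> \<notin> \<rat>" "conc N \<phi>" "2 \<le> N" "\<And>xs. hoch_b \<theta> \<phi> xs = 0"
  obtains \<psi> F where "ecoch act (chi \<theta>) (N - 1) \<psi>" "pcoch N F" "\<And>gs. dlt F gs = 0"
    "\<And>x gs. unroll \<theta> \<phi> x gs = dlt (\<psi> x) gs + at_one F x gs"
proof -
  have f: "ecoch act (chi \<theta>) N (unroll \<theta> \<phi>)"
    by (rule ecoch_unroll) (simp add: concD [OF assms(2)])
  have "hoch_b \<theta> \<phi> = (\<lambda>_. 0)" using assms(4) by blast
  then have 0: "dlt (unroll \<theta> \<phi> x) gs = 0" for x gs by (simp flip: unroll_hoch_b)
  obtain \<psi> where \<psi>: "ecoch act (chi \<theta>) (N - 1) \<psi>" "\<And>x gs. x \<noteq> one_mon \<Longrightarrow> dlt (\<psi> x) gs = unroll \<theta> \<phi> x gs"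
    "\<And>gs. \<psi> one_mon gs = 0"
    using reduce_to_unit [OF assms(1) f assms(3) 0] by metis
  have "\<psi> one_mon = (\<lambda>_. 0)" using \<psi>(3) by blast
  then have "unroll \<theta> \<phi> x gs = dlt (\<psi> x) gs + at_one (unroll \<theta> \<phi> one_mon) x gs" for x gs
    by (simp add: at_one_def \<psi>(2))
  then show thesis using that \<psi>(1) pcoch_at_one [OF f] 0 by blast
qed

lemma hochschild_coboundaryI:
  assumes \<psi>: "ecoch act (chi \<theta>) (N - 1) \<psi>" and "2 \<le> N" and "\<phi> [] = 0"
    and eq: "\<And>x gs. unroll \<theta> \<phi> x gs = dlt (\<psi> x) gs"
  obtains \<eta> where "conc (N - 1) \<eta>" "\<And>xs. hoch_b \<theta> \<eta> xs = \<phi> xs"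
proof
  show "conc (N - 1) (roll \<theta> \<psi>)" using conc_roll [OF \<psi>] assms(2) by simp
  show "hoch_b \<theta> (roll \<theta> \<psi>) xs = \<phi> xs" for xs
  proof (cases "xs = []")
    case False
    have "unroll \<theta> (roll \<theta> \<psi>) x gs = \<psi> x gs" for x gs
      using unroll_roll [OF \<psi>] ecoch_length [OF \<psi>, of "[]"] \<open>2 \<le> N\<close>
      by (cases "gs = []") (simp_all add: unroll_def)
    then have *: "unroll \<theta> (roll \<theta> \<psi>) x = \<psi> x" for x by blast
    show ?thesis
      by (rule unroll_inject [of \<theta>, OF _ False]) (simp add: unroll_hoch_b eq *)
  qed (simp add: hoch_b_short assms)
qed

text \<open>Only degrees 0 and 2 are left out. Off the unit class the prism and averaging
  contractions apply; on it, \<open>point_exact_1\<close> and \<open>point_exact_high\<close>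
  do.\<close>

theorem hochschild_exact:
  assumes "\<theta> \<notin> \<rat>" "conc N \<phi>" "2 \<le> N" "N \<noteq> 3" "\<And>xs. hoch_b \<theta> \<phi> xs = 0"
  obtains \<psi> where "conc (N - 1) \<psi>" "\<And>xs. hoch_b \<theta> \<psi> xs = \<phi> xs"
proof -
  obtain \<eta> F where \<eta>: "ecoch act (chi \<theta>) (N - 1) \<eta>" and F: "pcoch N F" "\<And>gs. dlt F gs = 0"
    and eq: "\<And>x gs. unroll \<theta> \<phi> x gs = dlt (\<eta> x) gs + at_one F x gs"
    using hochschild_cocycle_reduce [OF assms(1-3,5)] by metis
  consider "N = 2" | "4 \<le> N" using assms(3,4) by linarith
  then obtain G where G: "pcoch (N - 1) G" "\<And>gs. dlt G gs = F gs"
  proof cases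
    case 1
    then have "N - 1 = 1" by simp
    then show thesis using point_exact_1 [of F] F that unfolding 1 by metis
  next
    case 2
    then show thesis using point_exact_high [OF F(1) 2 F(2)] that by metis
  qed
  have a: "ecoch act (chi \<theta>) (N - 1) (\<lambda>x gs. \<eta> x gs + at_one G x gs)"
    by (intro ecoch_add \<eta> ecoch_at_one G)
  have b: "unroll \<theta> \<phi> x gs = dlt (\<lambda>gs. \<eta> x gs + at_one G x gs) gs" for x gs
    by (simp add: eq dlt_add dlt_at_one) (simp add: at_one_def G)
  have d: "\<phi> [] = 0" using concD [OF assms(2), of "[]"] assms(3) by simp
  show thesis using that by (rule hochschild_coboundaryI [OF a assms(3) d b])
qed

text \<open>On the torus subalgebra this is \<open>tau (a0 (d1 a1 d2 a2 - d2 a1 d1 a2))\<close>,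
  with \<open>tau\<close> the canonical trace and \<open>dj\<close> the derivations with
  \<open>dj Uj = Uj\<close> that kill the other generator.\<close>

definition omega :: "real \<Rightarrow> cochain" where
  "omega \<theta> = roll \<theta> (at_one area)"

lemma unroll_omega: "unroll \<theta> (omega \<theta>) x gs = at_one area x gs"
proof (cases "gs = []")
  case False
  then show ?thesis
    unfolding omega_def by (rule unroll_roll [OF ecoch_at_one [OF pcoch_area]])
qed (simp add: unroll_def at_one_def area_def)

lemma conc_omega: "conc 3 (omega \<theta>)"
  unfolding omega_def using ecoch_at_one [OF pcoch_area] by (rule conc_roll) simp

lemma hoch_b_omega: "hoch_b \<theta> (omega \<theta>) xs = 0"
proof (cases "xs = []")
  case False
  have "unroll \<theta> (omega \<theta>) x = at_one area x" for x using unroll_omega by blast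
  then have "unroll \<theta> (hoch_b \<theta> (omega \<theta>)) x gs = unroll \<theta> (\<lambda>_. 0) x gs" for x gs
    by (simp add: unroll_hoch_b dlt_at_one) (simp add: at_one_def dlt_area)
  then show ?thesis by (rule unroll_inject [OF _ False])
qed (simp add: hoch_b_short)

theorem hochschild_2:
  assumes "\<theta> \<notin> \<rat>" "conc 3 \<phi>" "\<And>xs. hoch_b \<theta> \<phi> xs = 0"
  obtains c \<psi> where "conc 2 \<psi>" "\<And>xs. hoch_b \<theta> \<psi> xs = \<phi> xs - c * omega \<theta> xs"
proof -
  obtain \<eta> F where \<eta>: "ecoch act (chi \<theta>) (3 - 1) \<eta>" and F: "pcoch 3 F" "\<And>gs. dlt F gs = 0"
    and eq: "\<And>x gs. unroll \<theta> \<phi> x gs = dlt (\<eta> x) gs + at_one F x gs"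
    using hochschild_cocycle_reduce [OF assms(1,2) _ assms(3)] by auto
  obtain c G where G: "pcoch 2 G" "\<And>gs. F gs = c * area gs + dlt G gs"
    using point_H2 [OF F] by metis
  have a: "ecoch act (chi \<theta>) (3 - 1) (\<lambda>x gs. \<eta> x gs + at_one G x gs)"
    using ecoch_add [OF \<eta> ecoch_at_one] G(1) by simp
  have b: "unroll \<theta> (\<lambda>xs. \<phi> xs + (- c) * omega \<theta> xs) x gs = dlt (\<lambda>gs. \<eta> x gs + at_one G x gs) gs" for x gs
    unfolding unroll_add unroll_cmult unroll_omega
    by (simp add: eq dlt_add dlt_at_one) (simp add: at_one_def G)
  have d: "\<phi> [] + (- c) * omega \<theta> [] = 0"
    using concD [OF assms(2), of "[]"] concD [OF conc_omega, of "[]"] by simp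
  obtain \<psi> where "conc (3 - 1) \<psi>" "\<And>xs. hoch_b \<theta> \<psi> xs = \<phi> xs + (- c) * omega \<theta> xs"
    by (rule hochschild_coboundaryI [OF a _ d b]) auto
  then show thesis using that [of \<psi> c] by simp
qed

lemma omega_not_coboundary:
  assumes "conc 2 \<psi>" "\<And>xs. length xs = 3 \<Longrightarrow> hoch_b \<theta> \<psi> xs = c * omega \<theta> xs"
  shows "c = 0"
proof -
  have \<psi>: "ecoch act (chi \<theta>) 2 (unroll \<theta> \<psi>)"
    by (rule ecoch_unroll) (simp add: concD [OF assms(1)])
  have "dlt (unroll \<theta> \<psi> one_mon) gs = c * area gs" for gs
  proof (cases "length gs = 3")
    case True
    then have ne: "gs \<noteq> []" by auto
    have "dlt (unroll \<theta> \<psi> one_mon) gs = unroll \<theta> (\<lambda>xs. c * omega \<theta> xs) one_mon gs"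
      unfolding unroll_hoch_b [symmetric] using True ne by (simp add: unroll_def assms(2))
    then show ?thesis by (simp add: unroll_cmult unroll_omega at_one_def)
  next
    case False
    then show ?thesis using ecoch_length [OF ecoch_dlt [OF \<psi>]] by (simp add: area_def)
  qed
  then show ?thesis using area_not_coboundary [OF pcoch_at_one [OF \<psi>]] by blast
qed

text \<open>The five conjugacy classes carrying traces: the unit, and the reflections according to
  the parities of their coordinates (class number 5 collects the rest).\<close>

fun cls :: "mon \<Rightarrow> nat" where
  "cls (v1, v2, e) = (if e then nat (1 + 2 * (v1 mod 2) + v2 mod 2)
     else if v1 = 0 \<and> v2 = 0 then 0 else 5)"

text \<open>Acting by \<open>h\<close> on a reflection increases the product \<open>v1 * v2\<close>
  of its coordinates by \<open>2 * conj_exp h x\<close>, so a half power of \<open>\<lambda>\<close>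
  in that product transforms exactly by \<open>chi\<close>.\<close>

fun trval :: "real \<Rightarrow> mon \<Rightarrow> complex" where
  "trval \<theta> (v1, v2, e) = (if e then lam (\<theta> / 2) (- (v1 * v2)) else 1)"

definition rep :: "nat \<Rightarrow> mon" where
  "rep i = (if i = 0 then one_mon else ((int i - 1) div 2, (int i - 1) mod 2, True))"

lemma trval_nonzero [simp]: "trval \<theta> x \<noteq> 0"
  by (cases x) simp

lemma cls_act: "cls (act h x) = cls x"
proof -
  obtain n m e v1 v2 f where hx: "h = (n, m, e)" "x = (v1, v2, f)" by (cases h; cases x)
  have "(2 * i - v) mod 2 = v mod 2" for i v :: int by presburger
  then show ?thesis by (cases f; cases e) (simp_all add: hx act_False act_True sg_def)
qed

lemma lam_half: "lam \<theta> k = lam (\<theta> / 2) (2 * k)"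
  by (simp add: lam_def)

lemma trval_act:
  assumes "cls x < 5"
  shows "trval \<theta> (act h x) = chi \<theta> h x * trval \<theta> x"
proof -
  obtain n m e v1 v2 f where hx: "h = (n, m, e)" "x = (v1, v2, f)" by (cases h; cases x)
  show ?thesis
  proof (cases f)
    case True
    then have "- ((2 * n + sg e * v1) * (2 * m + sg e * v2)) = 2 * (- conj_exp h x) + - (v1 * v2)"
      by (auto simp: hx conj_exp_True sg_def algebra_simps)
    then have "lam (\<theta> / 2) (- ((2 * n + sg e * v1) * (2 * m + sg e * v2)))
        = lam (\<theta> / 2) (2 * (- conj_exp h x)) * lam (\<theta> / 2) (- (v1 * v2))"
      by (simp only: lam_add)
    then show ?thesis using True unfolding chi_def lam_half [of \<theta>] by (simp add: hx act_True)
  next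
    case False
    then have "x = one_mon" using assms by (auto simp: hx one_mon_def split: if_splits)
    then show ?thesis by simp
  qed
qed

lemma cls_rep: "i < 5 \<Longrightarrow> cls (rep i) = i"
  by (auto simp: rep_def one_mon_def less_Suc_eq numeral_eq_Suc)

lemma act_rep:
  assumes "cls x < 5"
  shows "\<exists>h. x = act h (rep (cls x))"
proof -
  obtain v1 v2 f where x: "x = (v1, v2, f)" by (cases x)
  show ?thesis
  proof (cases f)
    case True
    have "v1 mod 2 = 0 \<or> v1 mod 2 = 1" "v2 mod 2 = 0 \<or> v2 mod 2 = 1" by presburger+
    then have "rep (cls x) = (v1 mod 2, v2 mod 2, True)"
      using True by (auto simp: x rep_def)
    then have "x = act (v1 div 2, v2 div 2, False) (rep (cls x))"
      using True by (simp add: x act_True sg_def)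
    then show ?thesis by blast
  next
    case False
    then have "x = one_mon" using assms by (auto simp: x one_mon_def split: if_splits)
    moreover have "cls one_mon = 0" by (simp add: one_mon_def)
    ultimately show ?thesis by (simp add: rep_def)
  qed
qed

definition trace :: "real \<Rightarrow> nat \<Rightarrow> cochain" where
  "trace \<theta> i = roll \<theta> (\<lambda>x gs. if length gs = 1 \<and> cls x = i then trval \<theta> x else 0)"

lemma ecoch_trace:
  "i < 5 \<Longrightarrow> ecoch act (chi \<theta>) 1 (\<lambda>x gs. if length gs = 1 \<and> cls x = i then trval \<theta> x else 0)"
  by (auto simp: ecoch_def cls_act trval_act simp del: split_paired_All)

lemma lexp_one: "lexp [one_mon] x = 0"
  by (cases x) (simp add: lexp_def sandwich_exp_def one_mon_def)

lemma loop_one: "loop [one_mon] x = [x]"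
  by (cases x) (simp add: loop_def one_mon_def sg_def)

lemma trace_single: "trace \<theta> i [x] = (if cls x = i then trval \<theta> x else 0)"
  by (simp add: trace_def roll_def Let_def lexp_one)

lemma conc_trace: "i < 5 \<Longrightarrow> conc 1 (trace \<theta> i)"
  unfolding trace_def using ecoch_trace by (rule conc_roll) simp_all

lemma hoch_b_trace:
  assumes "i < 5"
  shows "hoch_b \<theta> (trace \<theta> i) xs = 0"
proof (cases "xs = []")
  case False
  define f where "f = (\<lambda>x gs. if length (gs :: mon list) = 1 \<and> cls x = i then trval \<theta> x else 0)"
  have "unroll \<theta> (trace \<theta> i) x gs = f x gs" for x gs
    using unroll_roll [OF ecoch_trace [OF assms]]
    by (cases "gs = []") (simp_all add: trace_def f_def unroll_def)
  then have eq: "unroll \<theta> (trace \<theta> i) x = f x" for x by blast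
  have "dlt (f x) gs = 0" for x gs
  proof (cases "length gs = 2")
    case True
    then show ?thesis by (auto simp: numeral_2_eq_2 length_Suc_conv f_def)
  next
    case False
    then have "dlt (f x) gs = dlt (\<lambda>_. 0) gs" by (intro dlt_cong) (auto simp: f_def)
    then show ?thesis by simp
  qed
  then have "unroll \<theta> (hoch_b \<theta> (trace \<theta> i)) x gs = unroll \<theta> (\<lambda>_. 0) x gs" for x gs
    by (simp add: unroll_hoch_b eq)
  then show ?thesis by (rule unroll_inject [OF _ False])
qed (simp add: hoch_b_short)

lemma sum_trace_single:
  "(\<Sum>i<5. c i * trace \<theta> i [x]) = (if cls x < 5 then c (cls x) * trval \<theta> x else 0)"
  by (simp add: trace_single if_distrib [of "(*) _"] cong: if_cong)

text \<open>A cocycle of length 1 unrolls to a function of \<open>x\<close> alone that transforms by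
  \<open>chi\<close>. It is fixed by its value at one representative of each class, and on nonzero
  translations \<open>rot90\<close> forces it to vanish.\<close>

theorem hochschild_0:
  assumes "\<theta> \<notin> \<rat>" "conc 1 \<phi>" "\<And>xs. hoch_b \<theta> \<phi> xs = 0"
  obtains c where "\<And>xs. \<phi> xs = (\<Sum>i<5. c i * trace \<theta> i xs)"
proof -
  have f: "ecoch act (chi \<theta>) 1 (unroll \<theta> \<phi>)"
    by (rule ecoch_unroll) (simp add: concD [OF assms(2)])
  have "hoch_b \<theta> \<phi> = (\<lambda>_. 0)" using assms(3) by blast
  then have 0: "dlt (unroll \<theta> \<phi> x) gs = 0" for x gs by (simp flip: unroll_hoch_b)
  have one: "unroll \<theta> \<phi> x [one_mon] = \<phi> [x]" for x
    by (simp add: unroll_def lexp_one loop_one)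
  have inv: "\<phi> [act h x] = chi \<theta> h x * \<phi> [x]" for h x
    using ecoch_act [OF f, of h x "[one_mon]"] dlt_singleton_const [OF 0, of "act h x" h one_mon]
    by (simp add: one)
  have trans: "\<phi> [x] = 0" if "cls x \<ge> 5" for x
  proof -
    obtain v1 v2 e where x: "x = (v1, v2, e)" by (cases x)
    have "1 + 2 * (v1 mod 2) + v2 mod 2 < 5" by presburger
    then have "x \<in> trans_mons" using that by (auto simp: x trans_mons_def split: if_splits)
    then show ?thesis
      using inv [of "rot90 x" x] act_rot90 [of x] chi_rot90_neq_1 [OF assms(1)] by simp
  qed
  define c where "c = (\<lambda>i. \<phi> [rep i] / trval \<theta> (rep i))"
  have single: "\<phi> [x] = (\<Sum>i<5. c i * trace \<theta> i [x])" for x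
  proof (cases "cls x < 5")
    case True
    then obtain h where h: "x = act h (rep (cls x))" using act_rep by blast
    have "cls (rep (cls x)) < 5" using True by (simp add: cls_rep)
    then have "\<phi> [x] = chi \<theta> h (rep (cls x)) * \<phi> [rep (cls x)]"
      "trval \<theta> x = chi \<theta> h (rep (cls x)) * trval \<theta> (rep (cls x))"
      using inv [of h "rep (cls x)"] trval_act [of "rep (cls x)" \<theta> h] h by simp_all
    then have "c (cls x) * trval \<theta> x = \<phi> [x]" by (simp add: c_def)
    then show ?thesis using True unfolding sum_trace_single by simp
  next
    case False
    then show ?thesis unfolding sum_trace_single by (simp add: trans)
  qed
  have "\<phi> xs = (\<Sum>i<5. c i * trace \<theta> i xs)" for xs
  proof (cases "length xs = 1")
    case True
    then show ?thesis using single by (auto simp: length_Suc_conv)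
  next
    case False
    then show ?thesis using concD [OF assms(2)] concD [OF conc_trace] by simp
  qed
  then show thesis by (rule that)
qed

lemma trace_independent:
  assumes "\<And>xs. (\<Sum>i<5. c i * trace \<theta> i xs) = 0" "i < 5"
  shows "c i = 0"
  using assms(1) [of "[rep i]"] assms(2) unfolding sum_trace_single by (simp add: cls_rep)

section \<open>Periodic cyclic cohomology\<close>

lemma hoch_b_cong:
  assumes "\<And>ys. Suc (length ys) = length xs \<Longrightarrow> \<phi> ys = \<psi> ys"
  shows "hoch_b \<theta> \<phi> xs = hoch_b \<theta> \<psi> xs"
proof (cases "2 \<le> length xs")
  case True
  show ?thesis
    unfolding hoch_b_conjugates [OF True]
    by (intro sum.cong refl cyc_pow_cong mulfst_cong assms) simp
qed (simp add: hoch_b_short)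

lemma connes_B_cong:
  assumes "\<And>ys. length ys = Suc (length xs) \<Longrightarrow> \<phi> ys = \<psi> ys"
  shows "connes_B \<phi> xs = connes_B \<psi> xs"
  unfolding connes_B_cnorm by (rule cnorm_cong) (simp add: unit_ins_def assms)

lemma hoch_b_zero: "hoch_b \<theta> (\<lambda>_. 0) xs = 0"
  by (simp add: hoch_b_def Let_def split_beta)

lemma connes_B_zero: "connes_B (\<lambda>_. 0) xs = 0"
  by (simp add: connes_B_def Let_def)

lemma hoch_b_vanish: "(\<And>ys. Suc (length ys) = length xs \<Longrightarrow> \<phi> ys = 0) \<Longrightarrow> hoch_b \<theta> \<phi> xs = 0"
  using hoch_b_cong [of xs \<phi> "\<lambda>_. 0"] by (simp add: hoch_b_zero)

lemma connes_B_vanish: "(\<And>ys. length ys = Suc (length xs) \<Longrightarrow> \<phi> ys = 0) \<Longrightarrow> connes_B \<phi> xs = 0"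
  using connes_B_cong [of xs \<phi> "\<lambda>_. 0"] by (simp add: connes_B_zero)

lemma hoch_b_add: "hoch_b \<theta> (\<lambda>ys. \<phi> ys + \<psi> ys) xs = hoch_b \<theta> \<phi> xs + hoch_b \<theta> \<psi> xs"
  by (simp add: hoch_b_def Let_def split_beta sum.distrib algebra_simps)

lemma hoch_b_cmult: "hoch_b \<theta> (\<lambda>ys. c * \<phi> ys) xs = c * hoch_b \<theta> \<phi> xs"
  by (simp add: hoch_b_def Let_def split_beta sum_distrib_left algebra_simps)

lemma connes_B_add: "connes_B (\<lambda>ys. \<phi> ys + \<psi> ys) xs = connes_B \<phi> xs + connes_B \<psi> xs"
proof -
  have "unit_ins (\<lambda>ys. \<phi> ys + \<psi> ys) = (\<lambda>ys. unit_ins \<phi> ys + unit_ins \<psi> ys)"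
    by (auto simp: unit_ins_def algebra_simps)
  then show ?thesis by (simp add: connes_B_cnorm cnorm_add)
qed

lemma connes_B_cmult: "connes_B (\<lambda>ys. c * \<phi> ys) xs = c * connes_B \<phi> xs"
  by (simp add: connes_B_def Let_def sum_distrib_left algebra_simps)

lemma bB_add: "bB \<theta> (\<lambda>ys. \<phi> ys + \<psi> ys) xs = bB \<theta> \<phi> xs + bB \<theta> \<psi> xs"
  by (simp add: bB_def hoch_b_add connes_B_add)

lemma bB_cmult: "bB \<theta> (\<lambda>ys. c * \<phi> ys) xs = c * bB \<theta> \<phi> xs"
  by (simp add: bB_def hoch_b_cmult connes_B_cmult algebra_simps)

lemma bB_diff: "bB \<theta> (\<lambda>ys. \<phi> ys - \<psi> ys) xs = bB \<theta> \<phi> xs - bB \<theta> \<psi> xs"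
  using bB_add [of \<theta> \<phi> "\<lambda>ys. - 1 * \<psi> ys"] bB_cmult [of \<theta> "-1" \<psi>] by simp

lemma bB_bB: "bB \<theta> (bB \<theta> \<phi>) xs = 0"
  using hoch_b_connes_B [of \<theta> \<phi> xs]
  by (simp add: bB_def hoch_b_add connes_B_add hoch_b_hoch_b connes_B_connes_B)

lemma hoch_b_conc: "conc N \<phi> \<Longrightarrow> length xs \<noteq> Suc N \<Longrightarrow> hoch_b \<theta> \<phi> xs = 0"
  by (rule hoch_b_vanish) (auto simp: conc_def)

lemma connes_B_conc: "conc N \<phi> \<Longrightarrow> Suc (length xs) \<noteq> N \<Longrightarrow> connes_B \<phi> xs = 0"
  by (rule connes_B_vanish) (auto simp: conc_def)

lemma connes_B_Nil: "connes_B \<phi> [] = 0"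
  by (simp add: connes_B_def)

text \<open>\<open>B\<close> would lower degree 0 to degree -1, whose place is the empty list; there
  \<open>connes_B\<close> is zero by definition.\<close>

lemma connes_B_conc_1:
  assumes "conc 1 \<phi>"
  shows "connes_B \<phi> xs = 0"
  using connes_B_conc [OF assms] connes_B_Nil by (cases xs) auto

section \<open>Peeling off top components\<close>

definition component :: "nat \<Rightarrow> cochain \<Rightarrow> cochain" where
  "component N \<phi> xs = (if length xs = N then \<phi> xs else 0)"

lemma conc_component: "conc N (component N \<phi>)"
  by (simp add: conc_def component_def)

lemma hoch_b_component: "hoch_b \<theta> (component N \<phi>) xs = (if length xs = Suc N then hoch_b \<theta> \<phi> xs else 0)"
proof (cases "length xs = Suc N")
  case True
  then show ?thesis by (simp add: component_def cong: hoch_b_cong)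
qed (simp add: hoch_b_conc [OF conc_component])

lemma top_component_cocycle:
  assumes "\<And>xs. N < length xs \<Longrightarrow> \<phi> xs = 0" "\<And>xs. length xs = Suc N \<Longrightarrow> bB \<theta> \<phi> xs = 0"
  shows "hoch_b \<theta> (component N \<phi>) xs = 0"
proof (cases "length xs = Suc N")
  case True
  then have "connes_B \<phi> xs = 0" by (intro connes_B_vanish assms(1)) simp
  then show ?thesis using assms(2) [OF True] True by (simp add: hoch_b_component bB_def)
qed (simp add: hoch_b_component)

text \<open>A Hochschild primitive \<open>\<psi>\<close> of the top component has length
  \<open>N - 1\<close>; its \<open>B\<close> part lands in length \<open>N - 2\<close>, so nothing
  new appears at or above \<open>N\<close>.\<close>

lemma remove_top_component:
  assumes "\<theta> \<notin> \<rat>" "2 \<le> N" "N \<noteq> 3"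
    and top: "\<And>xs. N < length xs \<Longrightarrow> \<phi> xs = 0" and "\<And>xs. length xs = Suc N \<Longrightarrow> bB \<theta> \<phi> xs = 0"
  obtains \<psi> where "conc (N - 1) \<psi>" "\<And>xs. N \<le> length xs \<Longrightarrow> \<phi> xs - bB \<theta> \<psi> xs = 0"
proof -
  obtain \<psi> where \<psi>: "conc (N - 1) \<psi>" "\<And>xs. hoch_b \<theta> \<psi> xs = component N \<phi> xs"
    using hochschild_exact [OF assms(1) conc_component assms(2,3) top_component_cocycle [OF assms(4,5)]] by metis
  have "\<phi> xs - bB \<theta> \<psi> xs = 0" if "N \<le> length xs" for xs
  proof -
    have "connes_B \<psi> xs = 0" using that assms(2) by (intro connes_B_conc [OF \<psi>(1)]) simp
    then show ?thesis using that top [of xs] by (cases "N = length xs") (simp_all add: bB_def \<psi>(2) component_def)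
  qed
  then show thesis using that \<psi>(1) by blast
qed

lemma finitaryI: "(\<And>xs. N < length xs \<Longrightarrow> \<phi> xs = 0) \<Longrightarrow> finitary \<phi>"
  unfolding finitary_def by blast

lemma finitary_bB:
  assumes "finitary \<phi>"
  shows "finitary (bB \<theta> \<phi>)"
proof -
  obtain N where N: "\<And>xs. N < length xs \<Longrightarrow> \<phi> xs = 0" using assms unfolding finitary_def by blast
  have "bB \<theta> \<phi> xs = 0" if "Suc N < length xs" for xs
  proof -
    have "hoch_b \<theta> \<phi> xs = 0" using that by (intro hoch_b_vanish N) simp
    moreover have "connes_B \<phi> xs = 0" using that by (intro connes_B_vanish N) simp
    ultimately show ?thesis by (simp add: bB_def)
  qed
  then show ?thesis by (rule finitaryI)
qed

lemma finitary_add: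
  assumes "finitary \<phi>" "finitary \<psi>"
  shows "finitary (\<lambda>xs. \<phi> xs + \<psi> xs)"
proof -
  obtain M N where "\<And>xs. M < length xs \<Longrightarrow> \<phi> xs = 0" "\<And>xs. N < length xs \<Longrightarrow> \<psi> xs = 0"
    using assms unfolding finitary_def by blast
  then show ?thesis by (intro finitaryI [of "max M N"]) simp
qed

lemma finitary_cmult: "finitary \<phi> \<Longrightarrow> finitary (\<lambda>xs. c * \<phi> xs)"
  unfolding finitary_def by (metis mult_zero_right)

lemma even_cochain_bB:
  assumes "odd_cochain \<psi>"
  shows "even_cochain (bB \<theta> \<psi>)"
  unfolding even_cochain_def
proof (intro conjI allI impI)
  show "finitary (bB \<theta> \<psi>)" using assms finitary_bB by (simp add: odd_cochain_def)
  fix xs :: "mon list" assume ev: "even (length xs)"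
  have 0: "\<psi> ys = 0" if "odd (length ys)" for ys using assms that by (simp add: odd_cochain_def)
  have "hoch_b \<theta> \<psi> xs = 0"
  proof (rule hoch_b_vanish)
    fix ys :: "mon list" assume "Suc (length ys) = length xs"
    then show "\<psi> ys = 0" using ev by (intro 0) (metis even_Suc)
  qed
  moreover have "connes_B \<psi> xs = 0" using ev by (intro connes_B_vanish 0) simp
  ultimately show "bB \<theta> \<psi> xs = 0" by (simp add: bB_def)
qed

lemma odd_cochain_bB:
  assumes "even_cochain \<psi>"
  shows "odd_cochain (bB \<theta> \<psi>)"
  unfolding odd_cochain_def
proof (intro conjI allI impI)
  show "finitary (bB \<theta> \<psi>)" using assms finitary_bB by (simp add: even_cochain_def)
  show "bB \<theta> \<psi> [] = 0" by (simp add: bB_def hoch_b_short connes_B_Nil)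
  fix xs :: "mon list" assume od: "odd (length xs)"
  have 0: "\<psi> ys = 0" if "even (length ys)" for ys using assms that by (simp add: even_cochain_def)
  have "hoch_b \<theta> \<psi> xs = 0"
  proof (rule hoch_b_vanish)
    fix ys :: "mon list" assume "Suc (length ys) = length xs"
    then show "\<psi> ys = 0" using od by (intro 0) (metis even_Suc)
  qed
  moreover have "connes_B \<psi> xs = 0" using od by (intro connes_B_vanish 0) simp
  ultimately show "bB \<theta> \<psi> xs = 0" by (simp add: bB_def)
qed

lemma even_cochain_add: "even_cochain \<phi> \<Longrightarrow> even_cochain \<psi> \<Longrightarrow> even_cochain (\<lambda>xs. \<phi> xs + \<psi> xs)"
  by (simp add: even_cochain_def finitary_add)

lemma odd_cochain_add: "odd_cochain \<phi> \<Longrightarrow> odd_cochain \<psi> \<Longrightarrow> odd_cochain (\<lambda>xs. \<phi> xs + \<psi> xs)"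
  by (simp add: odd_cochain_def finitary_add)

lemma even_cochain_cmult: "even_cochain \<phi> \<Longrightarrow> even_cochain (\<lambda>xs. c * \<phi> xs)"
  by (simp add: even_cochain_def finitary_cmult)

lemma odd_cochain_cmult: "odd_cochain \<phi> \<Longrightarrow> odd_cochain (\<lambda>xs. c * \<phi> xs)"
  by (simp add: odd_cochain_def finitary_cmult)

lemma even_cochain_diff: "even_cochain \<phi> \<Longrightarrow> even_cochain \<psi> \<Longrightarrow> even_cochain (\<lambda>xs. \<phi> xs - \<psi> xs)"
  using even_cochain_add [of \<phi> "\<lambda>xs. (-1) * \<psi> xs"] even_cochain_cmult [of \<psi> "-1"] by simp

lemma odd_cochain_diff: "odd_cochain \<phi> \<Longrightarrow> odd_cochain \<psi> \<Longrightarrow> odd_cochain (\<lambda>xs. \<phi> xs - \<psi> xs)"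
  using odd_cochain_add [of \<phi> "\<lambda>xs. (-1) * \<psi> xs"] odd_cochain_cmult [of \<psi> "-1"] by simp

lemma finitary_conc: "conc N \<phi> \<Longrightarrow> finitary \<phi>"
  by (rule finitaryI [of N]) (simp add: conc_def)

lemma even_cochain_conc: "conc N \<phi> \<Longrightarrow> odd N \<Longrightarrow> even_cochain \<phi>"
  unfolding even_cochain_def using finitary_conc concD by metis

lemma odd_cochain_conc: "conc N \<phi> \<Longrightarrow> even N \<Longrightarrow> 0 < N \<Longrightarrow> odd_cochain \<phi>"
  unfolding odd_cochain_def using finitary_conc concD by (metis list.size(3) less_irrefl)

text \<open>Odd cochains live on lists of even length, so the exceptional length 3 never blocks the
  descent.\<close>

lemma odd_cocycle_coboundary:
  assumes "\<theta> \<notin> \<rat>" "odd_cochain \<phi>" "\<And>xs. bB \<theta> \<phi> xs = 0" "\<And>xs. 2 * M < length xs \<Longrightarrow> \<phi> xs = 0"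
  shows "\<exists>\<psi>. even_cochain \<psi> \<and> (\<forall>xs. \<phi> xs = bB \<theta> \<psi> xs)"
  using assms(2-)
proof (induction M arbitrary: \<phi>)
  case 0
  have "even_cochain (\<lambda>_. 0)" by (simp add: even_cochain_def finitary_def)
  moreover have "\<phi> xs = bB \<theta> (\<lambda>_. 0) xs" for xs
    using 0 by (cases xs) (simp_all add: odd_cochain_def bB_def hoch_b_zero connes_B_zero)
  ultimately show ?case by blast
next
  case (Suc M)
  obtain \<psi> where \<psi>: "conc (2 * Suc M - 1) \<psi>" "\<And>xs. 2 * Suc M \<le> length xs \<Longrightarrow> \<phi> xs - bB \<theta> \<psi> xs = 0"
    using remove_top_component [OF assms(1), of "2 * Suc M" \<phi>] Suc.prems(2,3) by (metis One_nat_def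
        Suc_1 even_Suc even_mult_iff even_numeral le_add1 mult_Suc_right numeral_3_eq_3)
  have ev: "even_cochain \<psi>" using even_cochain_conc [OF \<psi>(1)] by simp
  define \<phi>' where "\<phi>' = (\<lambda>xs. \<phi> xs - bB \<theta> \<psi> xs)"
  have "odd_cochain \<phi>'" unfolding \<phi>'_def by (intro odd_cochain_diff Suc.prems odd_cochain_bB ev)
  moreover have "bB \<theta> \<phi>' xs = 0" for xs unfolding \<phi>'_def by (simp add: bB_diff bB_bB Suc.prems)
  moreover have "\<phi>' xs = 0" if "2 * M < length xs" for xs
  proof (cases "length xs = Suc (2 * M)")
    case True
    then show ?thesis using \<open>odd_cochain \<phi>'\<close> by (simp add: odd_cochain_def)
  next
    case False
    then show ?thesis unfolding \<phi>'_def using that by (intro \<psi>(2)) simp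
  qed
  ultimately obtain \<eta> where \<eta>: "even_cochain \<eta>" "\<And>xs. \<phi>' xs = bB \<theta> \<eta> xs"
    using Suc.IH by blast
  have "\<phi> xs = bB \<theta> (\<lambda>ys. \<psi> ys + \<eta> ys) xs" for xs
    using \<eta>(2) [of xs] by (simp add: bB_add \<phi>'_def algebra_simps)
  then show ?case using even_cochain_add [OF ev \<eta>(1)] by blast
qed

text \<open>The descent through odd lengths can go down to the exceptional length 3, where
  \<open>omega\<close> obstructs it.\<close>

lemma even_cocycle_reduce:
  assumes "\<theta> \<notin> \<rat>" "even_cochain \<phi>" "\<And>xs. bB \<theta> \<phi> xs = 0" "\<And>xs. 2 * M + 3 < length xs \<Longrightarrow> \<phi> xs = 0"
  shows "\<exists>\<psi>. odd_cochain \<psi> \<and> (\<forall>xs. 3 < length xs \<longrightarrow> \<phi> xs - bB \<theta> \<psi> xs = 0)"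
  using assms(2-)
proof (induction M arbitrary: \<phi>)
  case 0
  have "odd_cochain (\<lambda>_. 0)" by (simp add: odd_cochain_def finitary_def)
  moreover have "\<phi> xs - bB \<theta> (\<lambda>_. 0) xs = 0" if "3 < length xs" for xs
    using 0(3) [of xs] that by (simp add: bB_def hoch_b_zero connes_B_zero)
  ultimately show ?case by blast
next
  case (Suc M)
  define N where "N = 2 * Suc M + 3"
  have N: "2 \<le> N" "N \<noteq> 3" "even (N - 1)" "0 < N - 1" by (simp_all add: N_def)
  obtain \<psi> where \<psi>: "conc (N - 1) \<psi>" "\<And>xs. N \<le> length xs \<Longrightarrow> \<phi> xs - bB \<theta> \<psi> xs = 0"
    using remove_top_component [OF assms(1) N(1,2), of \<phi>] Suc.prems(2,3) unfolding N_def by metis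
  have od: "odd_cochain \<psi>" using odd_cochain_conc [OF \<psi>(1) N(3,4)] .
  define \<phi>' where "\<phi>' = (\<lambda>xs. \<phi> xs - bB \<theta> \<psi> xs)"
  have ev: "even_cochain \<phi>'" unfolding \<phi>'_def by (intro even_cochain_diff Suc.prems even_cochain_bB od)
  moreover have "bB \<theta> \<phi>' xs = 0" for xs unfolding \<phi>'_def by (simp add: bB_diff bB_bB Suc.prems)
  moreover have "\<phi>' xs = 0" if "2 * M + 3 < length xs" for xs
  proof (cases "length xs = 2 * M + 4")
    case True
    then show ?thesis using ev by (simp add: even_cochain_def)
  next
    case False
    then show ?thesis unfolding \<phi>'_def using that by (intro \<psi>(2)) (simp add: N_def)
  qed
  ultimately obtain \<eta> where \<eta>: "odd_cochain \<eta>" "\<And>xs. 3 < length xs \<Longrightarrow> \<phi>' xs - bB \<theta> \<eta> xs = 0"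
    using Suc.IH by blast
  have "\<phi> xs - bB \<theta> (\<lambda>ys. \<psi> ys + \<eta> ys) xs = 0" if "3 < length xs" for xs
    using \<eta>(2) [OF that] by (simp add: bB_add \<phi>'_def algebra_simps)
  then show ?case using odd_cochain_add [OF od \<eta>(1)] by blast
qed

text \<open>For linear independence: a primitive may reach into high degrees, but where its
  \<open>bB\<close> vanishes its top component is a Hochschild coboundary. Subtracting
  \<open>bB \<theta> \<eta>\<close> removes it without changing \<open>bB\<close>, until only length
  2 is left.\<close>

lemma odd_cochain_reduce:
  assumes "\<theta> \<notin> \<rat>" "odd_cochain \<psi>" "\<And>xs. 3 < length xs \<Longrightarrow> bB \<theta> \<psi> xs = 0"
    "\<And>xs. 2 * M + 2 < length xs \<Longrightarrow> \<psi> xs = 0"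
  shows "\<exists>\<psi>'. conc 2 \<psi>' \<and> (\<forall>xs. bB \<theta> \<psi>' xs = bB \<theta> \<psi> xs)"
  using assms(2-)
proof (induction M arbitrary: \<psi>)
  case 0
  have "conc 2 \<psi>"
    unfolding conc_def
  proof (intro allI impI)
    fix xs :: "mon list" assume "length xs \<noteq> 2"
    then consider "xs = []" | "length xs = 1" | "2 < length xs"
      by (metis One_nat_def Suc_1 length_0_conv less_Suc_eq less_one linorder_neqE_nat)
    then show "\<psi> xs = 0" using 0 by cases (auto simp: odd_cochain_def)
  qed
  then show ?case by blast
next
  case (Suc M)
  define N where "N = 2 * Suc M + 2"
  have N: "2 \<le> N" "N \<noteq> 3" "odd (N - 1)" by (simp_all add: N_def)
  have top: "bB \<theta> \<psi> xs = 0" if "length xs = Suc N" for xs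
    using that by (intro Suc.prems) (simp add: N_def)
  obtain \<eta> where \<eta>: "conc (N - 1) \<eta>" "\<And>xs. N \<le> length xs \<Longrightarrow> \<psi> xs - bB \<theta> \<eta> xs = 0"
    using remove_top_component [OF assms(1) N(1,2), of \<psi>] Suc.prems(3) top unfolding N_def by metis
  have ev: "even_cochain \<eta>" using even_cochain_conc [OF \<eta>(1) N(3)] .
  define \<psi>' where "\<psi>' = (\<lambda>xs. \<psi> xs - bB \<theta> \<eta> xs)"
  have od: "odd_cochain \<psi>'" unfolding \<psi>'_def by (intro odd_cochain_diff Suc.prems odd_cochain_bB ev)
  have eq: "bB \<theta> \<psi>' xs = bB \<theta> \<psi> xs" for xs unfolding \<psi>'_def by (simp add: bB_diff bB_bB)
  have "\<psi>' xs = 0" if "2 * M + 2 < length xs" for xs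
  proof (cases "length xs = 2 * M + 3")
    case True
    then show ?thesis using od by (simp add: odd_cochain_def)
  next
    case False
    then show ?thesis unfolding \<psi>'_def using that by (intro \<eta>(2)) (simp add: N_def)
  qed
  then show ?case using Suc.IH [OF od] Suc.prems(2) eq by metis
qed

theorem theorem2:
  fixes \<theta> :: real
  assumes "\<theta> \<notin> \<rat>"
  shows "quotient_dim (HP_even_cocycles \<theta>) (HP_even_coboundaries \<theta>) 6
       \<and> quotient_dim (HP_odd_cocycles \<theta>) (HP_odd_coboundaries \<theta>) 0"
proof
  \<comment> \<open>\<open>B\<close> of \<open>omega\<close> is a Hochschild cocycle of degree 1,
    hence \<open>b\<close> of some \<open>\<omega>0\<close>. As \<open>B\<close> kills degree 0,
    \<open>omega - \<omega>0\<close> is a cocycle for \<open>b + B\<close>; this is the sixth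
    generator.\<close>
  have "conc 2 (connes_B (omega \<theta>))"
    unfolding conc_def using connes_B_conc [OF conc_omega] by simp
  moreover have "hoch_b \<theta> (connes_B (omega \<theta>)) xs = 0" for xs
  proof -
    have "hoch_b \<theta> (omega \<theta>) = (\<lambda>_. 0)" using hoch_b_omega by blast
    then show ?thesis using hoch_b_connes_B [of \<theta> "omega \<theta>" xs] by (simp add: connes_B_zero)
  qed
  ultimately obtain \<omega>0 where \<omega>0: "conc 1 \<omega>0" "\<And>xs. hoch_b \<theta> \<omega>0 xs = connes_B (omega \<theta>) xs"
    using hochschild_exact [OF assms, of 2 "connes_B (omega \<theta>)"] by auto
  define f where "f = (\<lambda>i. if i < 5 then trace \<theta> i else (\<lambda>xs. omega \<theta> xs - \<omega>0 xs))"
  have f5: "f 5 = (\<lambda>xs. omega \<theta> xs - \<omega>0 xs)" and f_trace: "\<And>i. i < 5 \<Longrightarrow> f i = trace \<theta> i"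
    by (simp_all add: f_def)
  have sum6: "(\<Sum>i<6. c i * f i xs) = (\<Sum>i<5. c i * trace \<theta> i xs) + c 5 * f 5 xs" for c :: "nat \<Rightarrow> complex" and xs
  proof -
    have "(\<Sum>i<Suc 5. c i * f i xs) = (\<Sum>i<5. c i * f i xs) + c 5 * f 5 xs" by (rule sum.lessThan_Suc)
    moreover have "(\<Sum>i<5. c i * f i xs) = (\<Sum>i<5. c i * trace \<theta> i xs)"
      by (rule sum.cong) (simp_all add: f_trace)
    ultimately show ?thesis by simp
  qed
  have f_even: "even_cochain (f i)" for i
    unfolding f_def
    using even_cochain_conc [OF conc_trace] even_cochain_diff [OF even_cochain_conc [OF conc_omega] even_cochain_conc [OF \<omega>0(1)]]
    by simp
  have f_cocycle: "bB \<theta> (f i) xs = 0" for i xs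
  proof (cases "i < 5")
    case True
    then show ?thesis by (simp add: f_trace bB_def hoch_b_trace connes_B_conc_1 [OF conc_trace])
  next
    case False
    then have "f i = (\<lambda>xs. omega \<theta> xs - \<omega>0 xs)" by (simp add: f_def)
    then show ?thesis
      by (simp add: bB_diff) (simp add: bB_def hoch_b_omega \<omega>0(2) connes_B_conc_1 [OF \<omega>0(1)])
  qed
  show "quotient_dim (HP_even_cocycles \<theta>) (HP_even_coboundaries \<theta>) 6"
    unfolding quotient_dim_def
  proof (intro exI [of _ f] conjI allI impI ballI)
    show "f i \<in> HP_even_cocycles \<theta>" for i
      using f_even f_cocycle by (auto simp: HP_even_cocycles_def)
  next
    fix \<phi> assume "\<phi> \<in> HP_even_cocycles \<theta>"
    then have \<phi>: "even_cochain \<phi>" and "bB \<theta> \<phi> = (\<lambda>_. 0)" by (auto simp: HP_even_cocycles_def)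
    then have D\<phi>: "bB \<theta> \<phi> xs = 0" for xs by simp
    obtain M where "\<And>xs. M < length xs \<Longrightarrow> \<phi> xs = 0"
      using \<phi> unfolding even_cochain_def finitary_def by blast
    then have "\<And>xs. 2 * M + 3 < length xs \<Longrightarrow> \<phi> xs = 0" by simp
    then obtain \<psi> where \<psi>: "odd_cochain \<psi>" "\<And>xs. 3 < length xs \<Longrightarrow> \<phi> xs - bB \<theta> \<psi> xs = 0"
      using even_cocycle_reduce [OF assms \<phi> D\<phi>] by blast
    define \<phi>1 where "\<phi>1 = (\<lambda>xs. \<phi> xs - bB \<theta> \<psi> xs)"
    have \<phi>1: "even_cochain \<phi>1" "\<And>xs. 3 < length xs \<Longrightarrow> \<phi>1 xs = 0" "\<And>xs. bB \<theta> \<phi>1 xs = 0"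
      using even_cochain_diff [OF \<phi> even_cochain_bB [OF \<psi>(1)]] \<psi>(2)
      by (simp_all add: \<phi>1_def bB_diff bB_bB D\<phi>)
    obtain c \<eta> where \<eta>: "conc 2 \<eta>" "\<And>xs. hoch_b \<theta> \<eta> xs = component 3 \<phi>1 xs - c * omega \<theta> xs"
      using hochschild_2 [OF assms conc_component top_component_cocycle [of 3 \<phi>1]] \<phi>1(2,3) by metis
    have \<eta>_odd: "odd_cochain \<eta>" using odd_cochain_conc [OF \<eta>(1)] by simp
    \<comment> \<open>This clears length 3, where \<open>c\<close> was determined. Even lengths
      vanish by parity, so what remains is a trace in length 1.\<close>
    define \<phi>2 where "\<phi>2 = (\<lambda>xs. \<phi>1 xs - c * f 5 xs - bB \<theta> \<eta> xs)"
    have \<phi>2_even: "even_cochain \<phi>2"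
      unfolding \<phi>2_def by (intro even_cochain_diff even_cochain_cmult f_even even_cochain_bB \<eta>_odd \<phi>1)
    have \<phi>2_cocycle: "bB \<theta> \<phi>2 xs = 0" for xs
      by (simp add: \<phi>2_def bB_diff bB_cmult bB_bB f_cocycle \<phi>1)
    have "\<phi>2 xs = 0" if "length xs \<noteq> 1" for xs
    proof (cases "even (length xs)")
      case True
      then show ?thesis using \<phi>2_even by (simp add: even_cochain_def)
    next
      case False
      then have "3 \<le> length xs" using that by presburger
      moreover from this have "connes_B \<eta> xs = 0" by (intro connes_B_conc [OF \<eta>(1)]) simp
      moreover have "\<omega>0 xs = 0" using that concD [OF \<omega>0(1)] by simp
      moreover have "omega \<theta> xs = 0" "\<phi>1 xs = 0" if "3 < length xs"
        using that concD [OF conc_omega] \<phi>1(2) by simp_all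
      ultimately show ?thesis
        by (cases "length xs = 3") (simp_all add: \<phi>2_def f5 bB_def \<eta>(2) component_def)
    qed
    then have \<phi>2_conc: "conc 1 \<phi>2" by (simp add: conc_def)
    have "hoch_b \<theta> \<phi>2 xs = 0" for xs
      using \<phi>2_cocycle [of xs] by (simp add: bB_def connes_B_conc_1 [OF \<phi>2_conc])
    then obtain d where d: "\<And>xs. \<phi>2 xs = (\<Sum>i<5. d i * trace \<theta> i xs)"
      using hochschild_0 [OF assms \<phi>2_conc] by metis
    have eq: "\<phi> xs - (\<Sum>i<6. (d(5 := c)) i * f i xs) = bB \<theta> (\<lambda>ys. \<psi> ys + \<eta> ys) xs" for xs
    proof -
      have "(\<Sum>i<5. (d(5 := c)) i * trace \<theta> i xs) = (\<Sum>i<5. d i * trace \<theta> i xs)"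
        by (rule sum.cong) simp_all
      then show ?thesis
        using d [of xs] unfolding sum6 by (simp add: bB_add \<phi>2_def \<phi>1_def algebra_simps)
    qed
    have "(\<lambda>xs. \<phi> xs - (\<Sum>i<6. (d(5 := c)) i * f i xs)) \<in> HP_even_coboundaries \<theta>"
      unfolding HP_even_coboundaries_def eq using odd_cochain_add [OF \<psi>(1) \<eta>_odd] by auto
    then show "\<exists>c. (\<lambda>xs. \<phi> xs - (\<Sum>i<6. c i * f i xs)) \<in> HP_even_coboundaries \<theta>" by blast
  next
    fix c :: "nat \<Rightarrow> complex" and i :: nat
    assume "(\<lambda>xs. \<Sum>i<6. c i * f i xs) \<in> HP_even_coboundaries \<theta>" and i: "i < 6"
    then obtain \<psi> where \<psi>: "odd_cochain \<psi>" and D: "(\<lambda>xs. \<Sum>i<6. c i * f i xs) = bB \<theta> \<psi>"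
      unfolding HP_even_coboundaries_def by blast
    have eq: "bB \<theta> \<psi> xs = (\<Sum>i<5. c i * trace \<theta> i xs) + c 5 * (omega \<theta> xs - \<omega>0 xs)" for xs
      using fun_cong [OF D, of xs] unfolding sum6 f5 by simp
    have tr0: "(\<Sum>i<5. c i * trace \<theta> i xs) = 0" "\<omega>0 xs = 0" if "length xs \<noteq> 1" for xs
      using that concD [OF conc_trace] concD [OF \<omega>0(1)] by simp_all
    have high: "bB \<theta> \<psi> xs = 0" if "3 < length xs" for xs
      using that concD [OF conc_omega] unfolding eq by (simp add: tr0)
    obtain M where "\<And>xs. M < length xs \<Longrightarrow> \<psi> xs = 0"
      using \<psi> unfolding odd_cochain_def finitary_def by blast
    then have "\<And>xs. 2 * M + 2 < length xs \<Longrightarrow> \<psi> xs = 0" by simp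
    then obtain \<psi>' where \<psi>': "conc 2 \<psi>'" "\<And>xs. bB \<theta> \<psi>' xs = bB \<theta> \<psi> xs"
      using odd_cochain_reduce [OF assms \<psi> high] by blast
    have b3: "hoch_b \<theta> \<psi>' xs = c 5 * omega \<theta> xs" if "length xs = 3" for xs
      using \<psi>'(2) [of xs] connes_B_conc [OF \<psi>'(1), of xs] that unfolding eq
      by (simp add: bB_def tr0)
    then have c5: "c 5 = 0" using omega_not_coboundary [OF \<psi>'(1)] by blast
    have "hoch_b \<theta> \<psi>' xs = 0" for xs
      using b3 [of xs] hoch_b_conc [OF \<psi>'(1), of xs] c5 by (cases "length xs = 3") simp_all
    \<comment> \<open>With \<open>c 5 = 0\<close>, \<open>\<psi>'\<close> is a Hochschild cocycle of
      degree 1, hence \<open>b \<eta>\<close>, which equals \<open>bB \<theta> \<eta>\<close> in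
      degree 0. So \<open>bB \<theta> \<psi>'\<close> is zero and the combination of traces vanishes
      identically, not just up to a coboundary.\<close>
    then obtain \<eta> where \<eta>: "conc 1 \<eta>" "\<And>xs. hoch_b \<theta> \<eta> xs = \<psi>' xs"
      using hochschild_exact [OF assms \<psi>'(1)] by auto
    have "bB \<theta> \<eta> = \<psi>'" using \<eta>(2) by (auto simp: bB_def connes_B_conc_1 [OF \<eta>(1)])
    then have "bB \<theta> \<psi>' xs = 0" for xs using bB_bB [of \<theta> \<eta>] by simp
    then have "(\<Sum>i<5. c i * trace \<theta> i xs) = 0" for xs
      using eq [of xs] c5 by (simp add: \<psi>'(2))
    then have "c i = 0" if "i < 5" using trace_independent that by blast
    then show "c i = 0" using i c5 by (cases "i = 5") simp_all
  qed
  show "quotient_dim (HP_odd_cocycles \<theta>) (HP_odd_coboundaries \<theta>) 0"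
    unfolding quotient_dim_def
  proof (intro exI [of _ f] conjI allI impI ballI)
    fix \<phi> assume "\<phi> \<in> HP_odd_cocycles \<theta>"
    then have \<phi>: "odd_cochain \<phi>" and "bB \<theta> \<phi> = (\<lambda>_. 0)" by (auto simp: HP_odd_cocycles_def)
    then have D\<phi>: "bB \<theta> \<phi> xs = 0" for xs by simp
    obtain M where "\<And>xs. M < length xs \<Longrightarrow> \<phi> xs = 0"
      using \<phi> unfolding odd_cochain_def finitary_def by blast
    then have "\<And>xs. 2 * M < length xs \<Longrightarrow> \<phi> xs = 0" by simp
    then obtain \<psi> where "even_cochain \<psi>" "\<And>xs. \<phi> xs = bB \<theta> \<psi> xs"
      using odd_cocycle_coboundary [OF assms \<phi> D\<phi>] by blast
    then have "\<phi> = bB \<theta> \<psi>" "even_cochain \<psi>" by blast+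
    then show "\<exists>c. (\<lambda>xs. \<phi> xs - (\<Sum>i<0. c i * f i xs)) \<in> HP_odd_coboundaries \<theta>"
      by (auto simp: HP_odd_coboundaries_def)
  qed simp_all
qed

end
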